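(* Let $(L,[\cdot,\cdot],\alpha,\beta)$ be a regular BiHom-Lie algebra over $\mathbb{C}$. Then $(C^*_{\mathrm{BiHom}}(L,L),[\cdot,\cdot]_{\mathrm{FN}})$ is a graded Lie algebra.
   Context: A BiHom-Lie algebra is a 4-tuple $(L,[\cdot,\cdot],\alpha,\beta)$ with $L$ a vector space over $\mathbb{C}$, $[\cdot,\cdot]:L\times L\to L$ bilinear, $\alpha,\beta:L\to L$ linear, such that for all $x,y,z\in L$: (i) $\alpha\circ\beta=\beta\circ\alpha$; (ii) $\alpha([x,y])=[\alpha(x),\alpha(y)]$ and $\beta([x,y])=[\beta(x),\beta(y)]$; (iii) $[\beta(x),\alpha(y)]=-[\beta(y),\alpha(x)]$; (iv) $[\beta^2(x),[\beta(y),\alpha(z)]]+[\beta^2(y),[\beta(z),\alpha(x)]]+[\beta^2(z),[\beta(x),\alpha(y)]]=0$. It is regular if $\alpha$ and $\beta$ are bijective. $C^*_{\mathrm{BiHom}}(L,L)=\bigoplus_{n\ge0}C^n_{\mathrm{BiHom}}(L,L)$, where $C^n_{\mathrm{BiHom}}(L,L)$ consists of multilinear maps $f:L^{\otimes n}\to L$ with $f\circ\alpha^{\otimes n}=\alpha\circ f$ and $f\circ\beta^{\otimes n}=\beta\circ f$. For $K\in C^k_{\mathrm{BiHom}}(L,L)$ and $L'\in C^l_{\mathrm{BiHom}}(L,L)$, the circle product $K\circ L'\in C^{k+l-1}_{\mathrm{BiHom}}(L,L)$ is $$(K\circ L')(x_1,\ldots,x_{k+l-1})=\sum_{\sigma\in\mathrm{Sh}(l,k-1)}(-1)^\sigma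 K\bigl(L'(x_{\sigma(1)},\ldots,x_{\sigma(l)}),\alpha^{l-1}\beta^{l-1}(x_{\sigma(l+1)}),\ldots,\alpha^{l-1}\beta^{l-1}(x_{\sigma(k+l-1)})\bigr),$$ where $\mathrm{Sh}(l,k-1)$ is the set of $(l,k-1)$-shuffles, $(-1)^\sigma$ is the sign of $\sigma$, and $\alpha^{l-1}\beta^{l-1}=(\alpha\circ\beta)^{l-1}$. The BiHom-Frölicher-Nijenhuis bracket is $[K,L']_{\mathrm{FN}}=K\circ L'-(-1)^{(k-1)(l-1)}L'\circ K$. In the grading, elements of $C^k_{\mathrm{BiHom}}(L,L)$ have degree $k-1$.
   Formalization: The n-cochains are required to be skew-symmetric multilinear maps commuting with α and β; for arbitrary multilinear maps the graded Jacobi identity fails, e.g. for α = β = id, zero bracket, L = C². *)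

theory Defs
  imports
    Complex_Main
    "HOL-Library.Function_Algebras"
    "HOL-Combinatorics.Permutations"
begin

section \<open>BiHom-Lie algebras\<close>

locale bihom_lie_algebra = vector_space scale
  for scale :: "complex \<Rightarrow> 'a::ab_group_add \<Rightarrow> 'a" +
  fixes brk :: "'a \<Rightarrow> 'a \<Rightarrow> 'a"
    and \<alpha> \<beta> :: "'a \<Rightarrow> 'a"
  assumes brk_linear_left: "\<And>y. Vector_Spaces.linear scale scale (\<lambda>x. brk x y)"
    and brk_linear_right: "\<And>x. Vector_Spaces.linear scale scale (\<lambda>y. brk x y)"
    and linear_\<alpha>: "Vector_Spaces.linear scale scale \<alpha>"
    and linear_\<beta>: "Vector_Spaces.linear scale scale \<beta>"
    and commute: "\<alpha> \<circ> \<beta> = \<beta> \<circ> \<alpha>"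
    and \<alpha>_brk: "\<And>x y. \<alpha> (brk x y) = brk (\<alpha> x) (\<alpha> y)"
    and \<beta>_brk: "\<And>x y. \<beta> (brk x y) = brk (\<beta> x) (\<beta> y)"
    and bihom_skew: "\<And>x y. brk (\<beta> x) (\<alpha> y) = - brk (\<beta> y) (\<alpha> x)"
    and bihom_jacobi: "\<And>x y z.
      brk (\<beta> (\<beta> x)) (brk (\<beta> y) (\<alpha> z)) +
      brk (\<beta> (\<beta> y)) (brk (\<beta> z) (\<alpha> x)) +
      brk (\<beta> (\<beta> z)) (brk (\<beta> x) (\<alpha> y)) = 0"

locale regular_bihom_lie_algebra = bihom_lie_algebra +
  assumes bij_\<alpha>: "bij \<alpha>"
    and bij_\<beta>: "bij \<beta>"


section \<open>Graded Lie algebras\<close>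

text \<open>
  A \<open>\<int>\<close>-graded Lie algebra: \<open>T\<close> is the internal direct sum of the subspaces \<open>V i\<close> (\<open>i \<in> \<int>\<close>) of an
  ambient vector space.
\<close>

locale graded_lie_algebra = vector_space scl
  for scl :: "'k::field_char_0 \<Rightarrow> 'v::ab_group_add \<Rightarrow> 'v" +
  fixes T :: "'v set"
    and V :: "int \<Rightarrow> 'v set"
    and br :: "'v \<Rightarrow> 'v \<Rightarrow> 'v"
  assumes subspace_component: "\<And>i. subspace (V i)"
    and total: "T = span (\<Union>i. V i)"
    and direct: "\<And>I f i. finite I \<Longrightarrow> (\<And>j. j \<in> I \<Longrightarrow> f j \<in> V j) \<Longrightarrow> (\<Sum>j\<in>I. f j) = 0 \<Longrightarrow>
      i \<in> I \<Longrightarrow> f i = 0"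
    and br_add_left: "\<And>x y z. x \<in> T \<Longrightarrow> y \<in> T \<Longrightarrow> z \<in> T \<Longrightarrow> br (x + y) z = br x z + br y z"
    and br_add_right: "\<And>x y z. x \<in> T \<Longrightarrow> y \<in> T \<Longrightarrow> z \<in> T \<Longrightarrow> br x (y + z) = br x y + br x z"
    and br_scale_left: "\<And>c x y. x \<in> T \<Longrightarrow> y \<in> T \<Longrightarrow> br (scl c x) y = scl c (br x y)"
    and br_scale_right: "\<And>c x y. x \<in> T \<Longrightarrow> y \<in> T \<Longrightarrow> br x (scl c y) = scl c (br x y)"
    and br_degree: "\<And>i j x y. x \<in> V i \<Longrightarrow> y \<in> V j \<Longrightarrow> br x y \<in> V (i + j)"
    and br_graded_skew: "\<And>i j x y. x \<in> V i \<Longrightarrow> y \<in> V j \<Longrightarrow>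
      br x y = - scl ((-1) powi (i * j)) (br y x)"
    and br_graded_jacobi: "\<And>i j k x y z. x \<in> V i \<Longrightarrow> y \<in> V j \<Longrightarrow> z \<in> V k \<Longrightarrow>
      br x (br y z) = br (br x y) z + scl ((-1) powi (i * j)) (br y (br x z))"


section \<open>Cochains\<close>

text \<open>
  An \<open>n\<close>-ary map \<open>L\<^sup>n \<rightarrow> L\<close> is a function on lists that is \<open>0\<close> on lists of length other than \<open>n\<close>, so that
  equality of functions is equality of \<open>n\<close>-ary maps. For \<open>n = 0\<close> it is an element of \<open>L\<close>, the value at \<open>[]\<close>.
\<close>

definition multilinear_map :: "(complex \<Rightarrow> 'a::ab_group_add \<Rightarrow> 'a) \<Rightarrow> nat \<Rightarrow> ('a list \<Rightarrow> 'a) \<Rightarrow> bool" where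
  "multilinear_map scale n f \<longleftrightarrow>
     (\<forall>xs. length xs \<noteq> n \<longrightarrow> f xs = 0) \<and>
     (\<forall>xs. length xs = n \<longrightarrow>
       (\<forall>i<n. Vector_Spaces.linear scale scale (\<lambda>x. f (xs[i := x]))))"

definition skew_symmetric_map :: "(complex \<Rightarrow> 'a::ab_group_add \<Rightarrow> 'a) \<Rightarrow> nat \<Rightarrow> ('a list \<Rightarrow> 'a) \<Rightarrow> bool" where
  "skew_symmetric_map scale n f \<longleftrightarrow>
     (\<forall>xs \<sigma>. length xs = n \<longrightarrow> \<sigma> permutes {..<n} \<longrightarrow>
       f (permute_list \<sigma> xs) = scale (of_int (sign \<sigma>)) (f xs))"

text \<open>
  Cochains are skew-symmetric, as always for a Nijenhuis-Richardson type shuffle product. Without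
  skew-symmetry the graded Jacobi identity fails: already for \<open>\<alpha> = \<beta> = id\<close> take the identity and a
  linear map \<open>B\<close> in degree \<open>0\<close> and a symmetric bilinear \<open>K\<close> with \<open>K (B x) y \<noteq> K (B y) x\<close> for some
  \<open>x\<close>, \<open>y\<close>.
\<close>

definition bihom_cochains ::
    "(complex \<Rightarrow> 'a::ab_group_add \<Rightarrow> 'a) \<Rightarrow> ('a \<Rightarrow> 'a) \<Rightarrow> ('a \<Rightarrow> 'a) \<Rightarrow> nat \<Rightarrow> ('a list \<Rightarrow> 'a) set" where
  "bihom_cochains scale \<alpha> \<beta> n =
     {f. multilinear_map scale n f \<and> skew_symmetric_map scale n f \<and>
         (\<forall>xs. length xs = n \<longrightarrow> f (map \<alpha> xs) = \<alpha> (f xs)) \<and>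
         (\<forall>xs. length xs = n \<longrightarrow> f (map \<beta> xs) = \<beta> (f xs))}"

definition arity_part :: "nat \<Rightarrow> ('a list \<Rightarrow> 'a::zero) \<Rightarrow> 'a list \<Rightarrow> 'a" where
  "arity_part n F = (\<lambda>xs. if length xs = n then F xs else 0)"

text \<open>
  The direct sum over all \<open>n\<close> of the spaces of \<open>n\<close>-cochains: a function on all lists encodes the family
  of its arity parts, of which only finitely many may be nonzero.
\<close>

definition bihom_cochains_total ::
    "(complex \<Rightarrow> 'a::ab_group_add \<Rightarrow> 'a) \<Rightarrow> ('a \<Rightarrow> 'a) \<Rightarrow> ('a \<Rightarrow> 'a) \<Rightarrow> ('a list \<Rightarrow> 'a) set" where
  "bihom_cochains_total scale \<alpha> \<beta> =
     {F. (\<forall>n. arity_part n F \<in> bihom_cochains scale \<alpha> \<beta> n) \<and> finite {n. arity_part n F \<noteq> 0}}"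

text \<open>\<open>k\<close>-cochains have degree \<open>k - 1\<close>; the degrees start at \<open>-1\<close>.\<close>

definition bihom_cochains_of_degree ::
    "(complex \<Rightarrow> 'a::ab_group_add \<Rightarrow> 'a) \<Rightarrow> ('a \<Rightarrow> 'a) \<Rightarrow> ('a \<Rightarrow> 'a) \<Rightarrow> int \<Rightarrow> ('a list \<Rightarrow> 'a) set" where
  "bihom_cochains_of_degree scale \<alpha> \<beta> i =
     (if i \<ge> -1 then bihom_cochains scale \<alpha> \<beta> (nat (i + 1)) else {0})"

definition pointwise_scale :: "(complex \<Rightarrow> 'a \<Rightarrow> 'a) \<Rightarrow> complex \<Rightarrow> ('a list \<Rightarrow> 'a) \<Rightarrow> 'a list \<Rightarrow> 'a" where
  "pointwise_scale scale c f = (\<lambda>xs. scale c (f xs))"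


section \<open>The circle product and the BiHom-Froelicher-Nijenhuis bracket\<close>

text \<open>\<open>(p, q)\<close>-shuffles, with indices starting from \<open>0\<close>.\<close>

definition shuffle_perms :: "nat \<Rightarrow> nat \<Rightarrow> (nat \<Rightarrow> nat) set" where
  "shuffle_perms p q =
     {\<sigma>. \<sigma> permutes {..<p + q} \<and> strict_mono_on {..<p} \<sigma> \<and> strict_mono_on {p..<p + q} \<sigma>}"

text \<open>The map \<open>\<alpha>\<^sup>l\<^sup>-\<^sup>1 \<beta>\<^sup>l\<^sup>-\<^sup>1\<close>. For \<open>l = 0\<close> it involves the inverses, which is where regularity is used.\<close>

definition twist :: "('a \<Rightarrow> 'a) \<Rightarrow> ('a \<Rightarrow> 'a) \<Rightarrow> nat \<Rightarrow> 'a \<Rightarrow> 'a" where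
  "twist \<alpha> \<beta> l = (if l = 0 then inv (\<alpha> \<circ> \<beta>) else (\<alpha> \<circ> \<beta>) ^^ (l - 1))"

text \<open>
  \<open>K \<circ> K'\<close> for \<open>K\<close> of arity \<open>k\<close> and \<open>K'\<close> of arity \<open>l\<close>. For \<open>k = 0\<close> the sum over the \<open>(l, -1)\<close>-shuffles is empty.
\<close>

definition circle_product ::
    "(complex \<Rightarrow> 'a::ab_group_add \<Rightarrow> 'a) \<Rightarrow> ('a \<Rightarrow> 'a) \<Rightarrow> ('a \<Rightarrow> 'a) \<Rightarrow> nat \<Rightarrow> nat \<Rightarrow>
     ('a list \<Rightarrow> 'a) \<Rightarrow> ('a list \<Rightarrow> 'a) \<Rightarrow> 'a list \<Rightarrow> 'a" where
  "circle_product scale \<alpha> \<beta> k l K K' = (\<lambda>xs.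
     if k = 0 \<or> length xs \<noteq> k + l - 1 then 0
     else \<Sum>\<sigma>\<in>shuffle_perms l (k - 1).
       scale (of_int (sign \<sigma>))
         (K (K' (map (\<lambda>i. xs ! \<sigma> i) [0..<l]) #
             map (\<lambda>i. twist \<alpha> \<beta> l (xs ! \<sigma> i)) [l..<k + l - 1])))"

definition fn_bracket_homogeneous ::
    "(complex \<Rightarrow> 'a::ab_group_add \<Rightarrow> 'a) \<Rightarrow> ('a \<Rightarrow> 'a) \<Rightarrow> ('a \<Rightarrow> 'a) \<Rightarrow> nat \<Rightarrow> nat \<Rightarrow>
     ('a list \<Rightarrow> 'a) \<Rightarrow> ('a list \<Rightarrow> 'a) \<Rightarrow> 'a list \<Rightarrow> 'a" where
  "fn_bracket_homogeneous scale \<alpha> \<beta> k l K K' =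
     circle_product scale \<alpha> \<beta> k l K K' -
     pointwise_scale scale ((-1) powi ((int k - 1) * (int l - 1)))
       (circle_product scale \<alpha> \<beta> l k K' K)"

text \<open>
  The bilinear extension to the direct sum: on \<open>n\<close> arguments, the arity parts \<open>k\<close> and \<open>l\<close> contribute
  exactly when \<open>k + l - 1 = n\<close>.
\<close>

definition fn_bracket ::
    "(complex \<Rightarrow> 'a::ab_group_add \<Rightarrow> 'a) \<Rightarrow> ('a \<Rightarrow> 'a) \<Rightarrow> ('a \<Rightarrow> 'a) \<Rightarrow>
     ('a list \<Rightarrow> 'a) \<Rightarrow> ('a list \<Rightarrow> 'a) \<Rightarrow> 'a list \<Rightarrow> 'a" where
  "fn_bracket scale \<alpha> \<beta> F G = (\<lambda>xs.
     \<Sum>(k, l) \<in> {(k, l). k + l = length xs + 1}.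
       fn_bracket_homogeneous scale \<alpha> \<beta> k l (arity_part k F) (arity_part l G) xs)"

end

theory Submission
  imports Defs
begin

text \<open>
  The bracket is the graded commutator of the circle product, so it suffices that the circle product
  is graded right pre-Lie: its associator \<open>(K \<star> L) \<star> M - K \<star> (L \<star> M)\<close> is graded symmetric in \<open>L\<close> and
  \<open>M\<close>. Skew-symmetry and the graded Jacobi identity of the commutator are then formal.

  A sum over shuffles is a signed sum over all ways to split the list of arguments into two
  sublists. Written in this way, as \<open>split_sum\<close>, it follows the recursion on lists, and two
  inductions give the only combinatorics needed: splitting is coassociative
  (\<open>split_sum_coassoc\<close>) and graded cocommutative (\<open>split_sum_cocomm\<close>). In \<open>(K \<star> L) \<star> M\<close> the
  argument \<open>M as\<close> of \<open>K \<star> L\<close> goes either into \<open>L\<close> or into \<open>K\<close>. By coassociativity, the terms of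
  the first kind add up to \<open>K \<star> (L \<star> M)\<close>. Those of the second kind have \<open>L\<close> and \<open>M\<close> side by side
  in \<open>K\<close>, so that cocommutativity and the skew-symmetry of \<open>K\<close> exchange them
  (\<open>side_by_side_symmetric\<close>). The twisting maps do no harm because they form a commuting
  family: the twists for the arities \<open>m + 1\<close> and \<open>n\<close> compose to the twist for \<open>m + n\<close>, and cochains
  commute with all of them.

  Two facts connect this with the definition by shuffles. A function that changes sign when adjacent
  entries of a list are exchanged transforms under every permutation by its sign
  (\<open>alternating_permute_list\<close>); this yields both that the circle product of cochains is
  skew-symmetric and that the sign of a shuffle is the sign attached to the corresponding splitting
  (\<open>sum_shuffle_perms_eq_split_sum\<close>). Since a cochain vanishes on lists of the wrong length, sums over
  all splittings need no bookkeeping of arities, and degrees may be arbitrary integers.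
\<close>

section \<open>Signed sums over the splittings of a list\<close>

text \<open>
  The multiple by \<open>(-1)\<^sup>n\<close>, in any abelian group. Only the parity of \<open>n\<close> matters; integers are allowed so
  that degrees, which start at \<open>-1\<close>, can be used directly.
\<close>

definition koszul :: "int \<Rightarrow> 'b \<Rightarrow> 'b::ab_group_add" where
  "koszul n v = (if even n then v else - v)"

lemma koszul_0 [simp]: "koszul n 0 = 0"
  by (simp add: koszul_def)

lemma koszul_add: "koszul n (u + v) = koszul n u + koszul n v"
  by (simp add: koszul_def)

lemma koszul_minus: "koszul n (- v) = - koszul n v"
  by (simp add: koszul_def)

lemma koszul_koszul: "koszul m (koszul n v) = koszul (m + n) v"
  by (auto simp: koszul_def)

lemma koszul_cong: "even m = even n \<Longrightarrow> koszul m v = koszul n v"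
  by (simp add: koszul_def)

lemma koszul_hom: "additive h \<Longrightarrow> h (koszul n v) = koszul n (h v)"
  by (simp add: koszul_def additive.minus)

text \<open>
  The signed sum of \<open>F ys zs\<close> over all splittings of a list into complementary sublists \<open>ys\<close> and \<open>zs\<close>,
  where the sign counts the pairs of entries whose order is reversed in \<open>ys @ zs\<close>: an entry
  that goes to \<open>zs\<close> has to pass all later entries that go to \<open>ys\<close>.
\<close>

fun split_sum :: "('a list \<Rightarrow> 'a list \<Rightarrow> 'b::ab_group_add) \<Rightarrow> 'a list \<Rightarrow> 'b" where
  "split_sum F [] = F [] []"
| "split_sum F (x # xs) =
     split_sum (\<lambda>ys zs. F (x # ys) zs) xs +
     split_sum (\<lambda>ys zs. koszul (int (length ys)) (F ys (x # zs))) xs"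

lemma split_sum_cong:
  assumes "\<And>ys zs. length ys + length zs = length xs \<Longrightarrow> F ys zs = G ys zs"
  shows "split_sum F xs = split_sum G xs"
  using assms
proof (induction xs arbitrary: F G)
  case (Cons x xs)
  show ?case
    unfolding split_sum.simps
    by (intro arg_cong2[where f = plus] Cons.IH) (auto intro!: arg_cong[where f = "koszul _"] Cons.prems)
qed simp

lemma split_sum_add: "split_sum (\<lambda>ys zs. F ys zs + G ys zs) xs = split_sum F xs + split_sum G xs"
  by (induction xs arbitrary: F G) (auto simp: koszul_add)

lemma split_sum_hom:
  assumes "additive h"
  shows "split_sum (\<lambda>ys zs. h (F ys zs)) xs = h (split_sum F xs)"
proof (induction xs arbitrary: F)
  case (Cons x xs)
  show ?case
    using Cons[of "\<lambda>ys zs. F (x # ys) zs"] Cons[of "\<lambda>ys zs. koszul (int (length ys)) (F ys (x # zs))"]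
    by (simp add: additive.add[OF assms] koszul_hom[OF assms])
qed simp

lemma additive_uminus: "additive (uminus :: 'b \<Rightarrow> 'b::ab_group_add)"
  by unfold_locales simp

lemma additive_koszul: "additive (koszul n :: 'b \<Rightarrow> 'b::ab_group_add)"
  by unfold_locales (rule koszul_add)

lemma split_sum_minus: "split_sum (\<lambda>ys zs. - F ys zs) xs = - split_sum F xs"
  by (rule split_sum_hom[OF additive_uminus])

lemma split_sum_koszul: "split_sum (\<lambda>ys zs. koszul n (F ys zs)) xs = koszul n (split_sum F xs)"
  by (rule split_sum_hom[OF additive_koszul])

lemma split_sum_zero [simp]: "split_sum (\<lambda>ys zs. 0) xs = 0"
  by (induction xs) auto

lemma split_sum_map: "split_sum F (map h xs) = split_sum (\<lambda>ys zs. F (map h ys) (map h zs)) xs"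
  by (induction xs arbitrary: F) auto

text \<open>
  Both sides are the signed sum over all splittings into three sublists. The signs agree because the
  head of the list, when it goes to the last part, passes the entries of the first two parts in one
  step or in two.
\<close>

lemma split_sum_coassoc:
  "split_sum (\<lambda>as bs. split_sum (\<lambda>ys zs. F as ys zs) bs) xs =
   split_sum (\<lambda>cs zs. split_sum (\<lambda>as ys. F as ys zs) cs) xs"
proof (induction xs arbitrary: F)
  case (Cons x xs)
  have "split_sum (\<lambda>as bs. split_sum (\<lambda>ys zs. F as ys zs) bs) (x # xs) =
     split_sum (\<lambda>as bs. split_sum (\<lambda>ys zs. F (x # as) ys zs) bs) xs +
     split_sum (\<lambda>as bs. split_sum (\<lambda>ys zs. koszul (int (length as)) (F as (x # ys) zs)) bs) xs +
     split_sum (\<lambda>as bs. split_sum (\<lambda>ys zs. koszul (int (length as) + int (length ys)) (F as ys (x # zs))) bs) xs"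
    by (simp add: koszul_add split_sum_add split_sum_koszul flip: koszul_koszul)
  also have "\<dots> =
     split_sum (\<lambda>cs zs. split_sum (\<lambda>as ys. F (x # as) ys zs) cs) xs +
     split_sum (\<lambda>cs zs. split_sum (\<lambda>as ys. koszul (int (length as)) (F as (x # ys) zs)) cs) xs +
     split_sum (\<lambda>cs zs. split_sum (\<lambda>as ys. koszul (int (length as) + int (length ys)) (F as ys (x # zs))) cs) xs"
    by (simp only: Cons.IH)
  also have "split_sum (\<lambda>cs zs. split_sum (\<lambda>as ys.
        koszul (int (length as) + int (length ys)) (F as ys (x # zs))) cs) xs =
      split_sum (\<lambda>cs zs. koszul (int (length cs)) (split_sum (\<lambda>as ys. F as ys (x # zs)) cs)) xs"
    unfolding split_sum_koszul[symmetric]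
    by (intro split_sum_cong) (metis of_nat_add)
  finally show ?case
    by (simp add: split_sum_add)
qed simp

text \<open>
  Moving all of \<open>ys\<close> past all of \<open>zs\<close> costs one sign for each pair of entries.
\<close>

lemma split_sum_cocomm:
  "split_sum F xs = split_sum (\<lambda>ys zs. koszul (int (length ys) * int (length zs)) (F zs ys)) xs"
proof (induction xs arbitrary: F)
  case (Cons x xs)
  have "split_sum (\<lambda>ys zs. F (x # ys) zs) xs =
      split_sum (\<lambda>ys zs. koszul (int (length ys)) (koszul (int (length ys) * int (length (x # zs))) (F (x # zs) ys))) xs"
    by (subst Cons.IH) (intro split_sum_cong, auto simp: koszul_koszul intro!: koszul_cong)
  moreover have "split_sum (\<lambda>ys zs. koszul (int (length ys)) (F ys (x # zs))) xs =
      split_sum (\<lambda>ys zs. koszul (int (length (x # ys)) * int (length zs)) (F zs (x # ys))) xs"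
    by (subst Cons.IH) (intro split_sum_cong, auto simp: koszul_koszul intro!: koszul_cong)
  ultimately show ?case
    by (simp add: add.commute)
qed (simp add: koszul_def)

section \<open>Alternating functions of lists\<close>

text \<open>
  Skew-symmetry in terms of adjacent exchanges only, without reference to the length of the list. In
  this form it can be checked by induction on the entries before the exchanged pair.
\<close>

definition alternating :: "('a list \<Rightarrow> 'b::ab_group_add) \<Rightarrow> bool" where
  "alternating f \<longleftrightarrow> (\<forall>us x y vs. f (us @ x # y # vs) = - f (us @ y # x # vs))"

lemma alternatingD: "alternating f \<Longrightarrow> f (us @ x # y # vs) = - f (us @ y # x # vs)"
  unfolding alternating_def by blast

lemma alternating_Cons: "alternating f \<Longrightarrow> alternating (\<lambda>ys. f (x # ys))"
  unfolding alternating_def by (metis append_Cons)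

lemma alternating_koszul:
  assumes "alternating f" "\<And>us x y vs. e (us @ x # y # vs) = e (us @ y # x # vs)"
  shows "alternating (\<lambda>ys. koszul (e ys) (f ys))"
  unfolding alternating_def
proof (intro allI)
  fix us x y vs
  show "koszul (e (us @ x # y # vs)) (f (us @ x # y # vs)) = - koszul (e (us @ y # x # vs)) (f (us @ y # x # vs))"
    unfolding alternatingD[OF assms(1), of us x y vs] assms(2)[of us x y vs] by (rule koszul_minus)
qed

text \<open>
  Exchanging two adjacent arguments \<open>x\<close> and \<open>y\<close>: if both go to the same part, the summand changes
  sign because \<open>F\<close> alternates there; the splittings that separate \<open>x\<close> and \<open>y\<close> are exchanged in
  pairs, and their signs differ by the one inversion between \<open>x\<close> and \<open>y\<close>.
\<close>

lemma split_sum_alternating: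
  assumes "\<And>zs. alternating (\<lambda>ys. F ys zs)" and "\<And>ys. alternating (\<lambda>zs. F ys zs)"
  shows "alternating (split_sum F)"
proof -
  have "split_sum F (us @ x # y # vs) = - split_sum F (us @ y # x # vs)" for us x y vs
    using assms
  proof (induction us arbitrary: F)
    case Nil
    have two: "split_sum F (a # b # vs) =
        split_sum (\<lambda>ys zs. F (a # b # ys) zs) vs + split_sum (\<lambda>ys zs. F ys (a # b # zs)) vs +
        (split_sum (\<lambda>ys zs. koszul (int (length ys)) (F (a # ys) (b # zs))) vs -
         split_sum (\<lambda>ys zs. koszul (int (length ys)) (F (b # ys) (a # zs))) vs)" for a b
    proof -
      have "koszul (1 + int n) v = - koszul (int n) v" "koszul (int n + int n) v = v" for n and v :: 'b
        by (simp_all add: koszul_def)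
      then show ?thesis
        by (simp add: koszul_koszul split_sum_minus)
    qed
    have swap: "F (x # y # ys) zs = - F (y # x # ys) zs" "F ys (x # y # zs) = - F ys (y # x # zs)" for ys zs
      using alternatingD[OF Nil(1)[of zs], of "[]" x y ys] alternatingD[OF Nil(2)[of ys], of "[]" x y zs]
      by (simp_all only: append_Nil)
    have "split_sum (\<lambda>ys zs. F (x # y # ys) zs) vs = - split_sum (\<lambda>ys zs. F (y # x # ys) zs) vs"
      "split_sum (\<lambda>ys zs. F ys (x # y # zs)) vs = - split_sum (\<lambda>ys zs. F ys (y # x # zs)) vs"
      unfolding split_sum_minus[symmetric] by (rule split_sum_cong, rule swap)+
    then show ?case
      unfolding append_Nil two by simp
  next
    case (Cons u us)
    have 1: "alternating (\<lambda>ys. F (u # ys) zs)" for zs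
      by (rule alternating_Cons[of "\<lambda>ys. F ys zs"]) (rule Cons.prems)
    have 2: "alternating (\<lambda>ys. koszul (int (length ys)) (F ys (u # zs)))" for zs
      by (rule alternating_koszul[OF Cons.prems(1)]) simp
    have 3: "alternating (\<lambda>zs. koszul n (F ys (u # zs)))" for ys n
      by (rule alternating_koszul[OF alternating_Cons[OF Cons.prems(2)]]) simp
    have "split_sum (\<lambda>ys zs. F (u # ys) zs) (us @ x # y # vs) =
        - split_sum (\<lambda>ys zs. F (u # ys) zs) (us @ y # x # vs)"
      by (rule Cons.IH) (rule 1 Cons.prems(2))+
    moreover have "split_sum (\<lambda>ys zs. koszul (int (length ys)) (F ys (u # zs))) (us @ x # y # vs) =
        - split_sum (\<lambda>ys zs. koszul (int (length ys)) (F ys (u # zs))) (us @ y # x # vs)"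
      by (rule Cons.IH) (rule 2 3)+
    ultimately show ?case
      by simp
  qed
  then show ?thesis
    unfolding alternating_def by blast
qed

lemma permute_list_adjacent_transpose:
  "permute_list (Transposition.transpose (length us) (Suc (length us))) (us @ x # y # vs) = us @ y # x # vs"
proof (rule nth_equalityI)
  fix i assume "i < length (permute_list (Transposition.transpose (length us) (Suc (length us))) (us @ x # y # vs))"
  then have i: "i < length us + length vs + 2"
    by simp
  consider "i < length us" | "i = length us" | "i = Suc (length us)" | "Suc (length us) < i"
    by linarith
  then have "(us @ x # y # vs) ! Transposition.transpose (length us) (Suc (length us)) i = (us @ y # x # vs) ! i"
    by cases (auto simp: nth_append transpose_def nth_Cons split: nat.splits)
  with i show "permute_list (Transposition.transpose (length us) (Suc (length us))) (us @ x # y # vs) ! i =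
      (us @ y # x # vs) ! i"
    by (simp add: permute_list_def del: upt_Suc)
qed simp

text \<open>
  Every transposition is a product of an odd number of adjacent ones, which reduces arbitrary
  permutations to the defining property of alternating functions.
\<close>

lemma alternating_adj_transps:
  assumes "alternating f" "\<forall>i\<in>set ts. Suc i < length xs"
  shows "f (permute_list (apply_adj_transps ts) xs) = koszul (int (length ts)) (f xs)"
  using assms(2)
proof (induction ts arbitrary: xs)
  case Nil
  then show ?case by (simp add: koszul_def id_def)
next
  case (Cons i ts)
  \<comment> \<open>cut out the pair at positions \<open>i\<close> and \<open>i + 1\<close>\<close>
  define us x y vs where "us = take i xs" and "x = xs ! i" and "y = xs ! Suc i" and "vs = drop (Suc (Suc i)) xs"
  have xs: "xs = us @ x # y # vs" and i: "length us = i"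
    using Cons.prems by (auto simp: us_def x_def y_def vs_def Cons_nth_drop_Suc)
  have "apply_adj_transps ts permutes {..<length xs}"
    using Cons.prems by (intro permutes_apply_adj_transps) auto
  then have "f (permute_list (apply_adj_transps (i # ts)) xs) =
      f (permute_list (apply_adj_transps ts) (permute_list (Transposition.transpose i (Suc i)) xs))"
    by (simp add: permute_list_compose)
  also have "\<dots> = koszul (int (length ts)) (f (permute_list (Transposition.transpose i (Suc i)) xs))"
    using Cons.prems by (intro Cons.IH) auto
  also have "f (permute_list (Transposition.transpose i (Suc i)) xs) = - f xs"
    using permute_list_adjacent_transpose[of us x y vs] alternatingD[OF assms(1), of us x y vs] by (simp add: xs i)
  finally show ?case
    by (simp add: koszul_def)
qed

lemma alternating_permute_list:
  assumes "alternating f" "\<sigma> permutes {..<length xs}"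
  shows "f (permute_list \<sigma> xs) = (if sign \<sigma> = 1 then f xs else - f xs)"
proof -
  have "\<forall>xs. length xs = n \<longrightarrow> f (permute_list \<sigma> xs) = (if sign \<sigma> = 1 then f xs else - f xs)"
    if "\<sigma> permutes {..<n}" for n
    using that finite_lessThan
  proof (induction rule: permutes_induct)
    case id
    then show ?case by (simp add: id_def)
  next
    case (swap a b p)
    have transp: "f (permute_list (Transposition.transpose a b) xs) = - f xs"
      if "length xs = n" "a < b" "b < n" for a b xs
      using that alternating_adj_transps[OF assms(1), of "adj_transp_seq a b" xs]
      by (auto simp: adj_transp_seq_correct set_adj_transp_seq length_adj_transp_seq koszul_def)
    have "f (permute_list (Transposition.transpose a b) xs) = - f xs" if "length xs = n" for xs
      using transp[of xs a b] transp[of xs b a] swap(1-3) that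
      by (cases "a < b") (auto simp: transpose_commute)
    moreover have "sign (Transposition.transpose a b \<circ> p) = - sign p"
      using swap by (subst sign_compose) (auto simp: sign_swap_id intro: permutes_imp_permutation permutation_swap_id)
    moreover have "f (permute_list (Transposition.transpose a b \<circ> p) xs) =
        (if sign p = 1 then f (permute_list (Transposition.transpose a b) xs)
         else - f (permute_list (Transposition.transpose a b) xs))" if "length xs = n" for xs
      using swap that by (subst permute_list_compose) auto
    ultimately have "f (permute_list (Transposition.transpose a b \<circ> p) xs) =
        (if sign (Transposition.transpose a b \<circ> p) = 1 then f xs else - f xs)" if "length xs = n" for xs
      by (cases p rule: sign_cases) (simp_all only: that, simp_all)
    then show ?case by blast
  qed
  from this[OF assms(2)] show ?thesis by simp
qed

section \<open>Shuffles as splittings\<close>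

text \<open>
  The sign of the Vandermonde product of a list. It is alternating by construction, which makes it a
  sign of permutations that is compatible with recursion on lists.
\<close>

fun inversion_sign :: "nat list \<Rightarrow> int" where
  "inversion_sign [] = 1"
| "inversion_sign (x # xs) = (\<Prod>y\<leftarrow>xs. sgn (int y - int x)) * inversion_sign xs"

lemma alternating_inversion_sign: "alternating inversion_sign"
proof -
  have "inversion_sign (us @ x # y # vs) = - inversion_sign (us @ y # x # vs)" for us x y vs
  proof (induction us)
    case Nil
    have "sgn (int y - int x) = - sgn (int x - int y)"
      by (simp add: sgn_if)
    then show ?case by (simp add: algebra_simps)
  qed (simp add: algebra_simps)
  then show ?thesis unfolding alternating_def by blast
qed

lemma prod_sgn_least: "(\<And>y. y \<in> set xs \<Longrightarrow> x < y) \<Longrightarrow> (\<Prod>y\<leftarrow>xs. sgn (int y - int x)) = 1"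
  by (induction xs) auto

lemma inversion_sign_sorted: "sorted_wrt (<) xs \<Longrightarrow> inversion_sign xs = 1"
  by (induction xs) (auto simp: prod_sgn_least)

text \<open>
  An alternating function takes the value \<open>sign \<sigma>\<close> on the permuted list as soon as it is \<open>1\<close> on the sorted one.
\<close>

lemma sign_eq_inversion_sign:
  assumes "\<sigma> permutes {..<n}"
  shows "sign \<sigma> = inversion_sign (map \<sigma> [0..<n])"
proof -
  have "permute_list \<sigma> [0..<n] = map \<sigma> [0..<n]"
    using permutes_in_image[OF assms] by (auto simp: permute_list_def)
  then show ?thesis
    using alternating_permute_list[OF alternating_inversion_sign, of \<sigma> "[0..<n]"] assms
      inversion_sign_sorted[of "[0..<n]"]
    by (auto simp: sign_def)
qed

lemma inversion_sign_insert_least: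
  assumes "\<And>y. y \<in> set (ys @ zs) \<Longrightarrow> x < y"
  shows "inversion_sign (ys @ x # zs) = (-1) ^ length ys * inversion_sign (ys @ zs)"
  using assms
  by (induction ys) (auto simp: prod_sgn_least)

lemma (in vector_space) scale_sign_power: "scale (of_int ((-1) ^ n * k)) v = koszul (int n) (scale (of_int k) v)"
  by (cases "even n") (auto simp: koszul_def)

text \<open>
  A splitting of a strictly sorted list is determined by the set of entries of its first part. The
  subsets with and without the least entry correspond to the two branches of the recursion of
  \<open>split_sum\<close>.
\<close>

lemma (in vector_space) split_sum_eq_sum_subsets:
  fixes F :: "nat list \<Rightarrow> nat list \<Rightarrow> 'b"
  assumes "sorted_wrt (<) xs"
  shows "split_sum F xs = (\<Sum>A\<in>Pow (set xs).
    scale (of_int (inversion_sign (sorted_list_of_set A @ sorted_list_of_set (set xs - A))))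
      (F (sorted_list_of_set A) (sorted_list_of_set (set xs - A))))"
  using assms
proof (induction xs arbitrary: F)
  case Nil
  then show ?case by simp
next
  case (Cons x xs)
  define sl :: "nat set \<Rightarrow> nat list" where "sl = sorted_list_of_set"
  define h where "h = (\<lambda>A. scale (of_int (inversion_sign (sl A @ sl (set (x # xs) - A)))) (F (sl A) (sl (set (x # xs) - A))))"
  have x: "x < y" if "y \<in> set xs" for y
    using Cons.prems that by simp
  have xs: "sorted_wrt (<) xs" using Cons.prems by simp
  have sl_insert: "sl (insert x A) = x # sl A" if "A \<subseteq> set xs" for A
  proof -
    have "finite A" using that finite_subset by blast
    then have "sorted_wrt (<) (x # sl A)" "set (x # sl A) = insert x A"
      using that x by (auto simp: sl_def)
    with \<open>finite A\<close> show ?thesis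
      unfolding sl_def by (metis finite_insert set_sorted_list_of_set strict_sorted_equal strict_sorted_list_of_set)
  qed
  have set_sl: "set (sl A) \<subseteq> A" for A
    unfolding sl_def by (cases "finite A") auto
  have "(\<Sum>A\<in>Pow (set (x # xs)). h A) = (\<Sum>A\<in>Pow (set xs). h A) + (\<Sum>A\<in>insert x ` Pow (set xs). h A)"
    using x by (simp only: list.simps Pow_insert, intro sum.union_disjoint) auto
  also have "(\<Sum>A\<in>insert x ` Pow (set xs). h A) = (\<Sum>A\<in>Pow (set xs). h (insert x A))"
  proof (subst sum.reindex)
    have "x \<notin> A" if "A \<in> Pow (set xs)" for A
      using that x by blast
    then show "inj_on (insert x) (Pow (set xs))"
      by (intro inj_onI) (metis insert_ident)
  qed simp
  also have "\<dots> = (\<Sum>A\<in>Pow (set xs). scale (of_int (inversion_sign (sl A @ sl (set xs - A)))) (F (x # sl A) (sl (set xs - A))))"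
  proof (intro sum.cong refl)
    fix A assume "A \<in> Pow (set xs)"
    moreover have "set (x # xs) - insert x A = set xs - A"
      using x by auto
    moreover have "inversion_sign (x # sl A @ sl (set xs - A)) = inversion_sign (sl A @ sl (set xs - A))"
      using calculation x set_sl[of A] set_sl[of "set xs - A"] inversion_sign_insert_least[of "[]" "sl A @ sl (set xs - A)" x]
      by fastforce
    ultimately show "h (insert x A) = scale (of_int (inversion_sign (sl A @ sl (set xs - A)))) (F (x # sl A) (sl (set xs - A)))"
      by (simp add: h_def sl_insert del: inversion_sign.simps)
  qed
  also have "\<dots> = split_sum (\<lambda>ys zs. F (x # ys) zs) xs"
    unfolding sl_def by (subst Cons.IH[OF xs]) simp
  also have "(\<Sum>A\<in>Pow (set xs). h A) = (\<Sum>A\<in>Pow (set xs). scale (of_int (inversion_sign (sl A @ sl (set xs - A))))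
      (koszul (int (length (sl A))) (F (sl A) (x # sl (set xs - A)))))"
  proof (intro sum.cong refl)
    fix A assume A: "A \<in> Pow (set xs)"
    moreover have "set (x # xs) - A = insert x (set xs - A)"
      using A x by auto
    moreover have "inversion_sign (sl A @ x # sl (set xs - A)) = (-1) ^ length (sl A) * inversion_sign (sl A @ sl (set xs - A))"
      by (rule inversion_sign_insert_least) (use A x set_sl[of A] set_sl[of "set xs - A"] in auto)
    ultimately show "h A = scale (of_int (inversion_sign (sl A @ sl (set xs - A))))
        (koszul (int (length (sl A))) (F (sl A) (x # sl (set xs - A))))"
      by (simp add: h_def sl_insert scale_sign_power del: of_int_mult) (simp add: koszul_def)
  qed
  also have "\<dots> = split_sum (\<lambda>ys zs. koszul (int (length ys)) (F ys (x # zs))) xs"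
    unfolding sl_def by (subst Cons.IH[OF xs]) simp
  finally show ?case
    by (simp add: h_def sl_def add.commute)
qed

text \<open>
  A shuffle is increasing on both blocks, so it lists the image of the first block and its complement
  in sorted order.
\<close>

lemma shuffle_perms_blocks:
  assumes "\<sigma> \<in> shuffle_perms p q"
  shows "map \<sigma> [0..<p] = sorted_list_of_set (\<sigma> ` {..<p})"
    and "map \<sigma> [p..<p + q] = sorted_list_of_set ({..<p + q} - \<sigma> ` {..<p})"
proof -
  have \<sigma>: "\<sigma> permutes {..<p + q}" "strict_mono_on {..<p} \<sigma>" "strict_mono_on {p..<p + q} \<sigma>"
    using assms by (auto simp: shuffle_perms_def)
  have "\<sigma> ` {p..<p + q} = \<sigma> ` ({..<p + q} - {..<p})"
    by (rule arg_cong[where f = "image \<sigma>"]) auto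
  also have "\<dots> = {..<p + q} - \<sigma> ` {..<p}"
    by (simp only: image_set_diff[OF permutes_inj[OF \<sigma>(1)]] permutes_image[OF \<sigma>(1)])
  finally have im: "\<sigma> ` {p..<p + q} = {..<p + q} - \<sigma> ` {..<p}" .
  have "sorted_wrt (<) (map \<sigma> [0..<p])" "sorted_wrt (<) (map \<sigma> [p..<p + q])"
    using \<sigma>(2,3) by (auto simp: sorted_wrt_iff_nth_less strict_mono_on_def)
  then show "map \<sigma> [0..<p] = sorted_list_of_set (\<sigma> ` {..<p})"
    and "map \<sigma> [p..<p + q] = sorted_list_of_set ({..<p + q} - \<sigma> ` {..<p})"
    using im by (auto intro!: strict_sorted_equal simp: atLeast0LessThan)
qed

lemma bij_betw_shuffle_perms_subsets:
  "bij_betw (\<lambda>\<sigma>. \<sigma> ` {..<p}) (shuffle_perms p q) {A \<in> Pow {..<p + q}. card A = p}"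
  unfolding bij_betw_def
proof (intro conjI inj_onI equalityI subsetI)
  fix \<sigma> \<tau> assume \<sigma>\<tau>: "\<sigma> \<in> shuffle_perms p q" "\<tau> \<in> shuffle_perms p q" "\<sigma> ` {..<p} = \<tau> ` {..<p}"
  have "map \<sigma> ([0..<p] @ [p..<p + q]) = map \<tau> ([0..<p] @ [p..<p + q])"
    by (simp only: map_append shuffle_perms_blocks[OF \<sigma>\<tau>(1)] shuffle_perms_blocks[OF \<sigma>\<tau>(2)] \<sigma>\<tau>(3))
  then have "\<sigma> i = \<tau> i" if "i < p + q" for i
    using that by (cases "i < p") auto
  moreover have "\<sigma> i = \<tau> i" if "\<not> i < p + q" for i
    using \<sigma>\<tau>(1,2) that permutes_not_in[of \<sigma> "{..<p + q}" i]
      permutes_not_in[of \<tau> "{..<p + q}" i] by (simp add: shuffle_perms_def)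
  ultimately show "\<sigma> = \<tau>" by blast
next
  fix A assume "A \<in> (\<lambda>\<sigma>. \<sigma> ` {..<p}) ` shuffle_perms p q"
  then obtain \<sigma> where \<sigma>: "\<sigma> \<in> shuffle_perms p q" "A = \<sigma> ` {..<p}" by blast
  then have p: "\<sigma> permutes {..<p + q}" by (simp add: shuffle_perms_def)
  have "A \<subseteq> {..<p + q}"
    using permutes_image[OF p] \<sigma>(2) by auto
  moreover have "card A = p"
    using \<sigma>(2) by (simp add: card_image inj_on_subset[OF permutes_inj[OF p]])
  ultimately show "A \<in> {A \<in> Pow {..<p + q}. card A = p}" by simp
next
  fix A assume "A \<in> {A \<in> Pow {..<p + q}. card A = p}"
  then have A: "A \<subseteq> {..<p + q}" "card A = p" "finite A"
    using finite_subset by auto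
  define ys zs where "ys = sorted_list_of_set A" and "zs = sorted_list_of_set ({..<p + q} - A)"
  have ys: "length ys = p" "set ys = A" "sorted_wrt (<) ys" and zs: "set zs = {..<p + q} - A" "sorted_wrt (<) zs"
    using A by (auto simp: ys_def zs_def)
  have lzs: "length zs = q"
    using A by (simp add: zs_def card_Diff_subset)
  \<comment> \<open>the shuffle belonging to \<open>A\<close> lists \<open>A\<close> and then its complement in increasing order\<close>
  define \<sigma> where "\<sigma> = (\<lambda>i. if i < p + q then (ys @ zs) ! i else i)"
  have "distinct (ys @ zs)"
    using ys zs by (auto simp: strict_sorted_iff)
  then have "bij_betw ((!) (ys @ zs)) {..<p + q} {..<p + q}"
    by (intro bij_betw_nth) (use ys zs lzs A in auto)
  then have "bij_betw \<sigma> {..<p + q} {..<p + q}"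
    by (rule bij_betw_cong[THEN iffD1, rotated]) (simp add: \<sigma>_def)
  then have perm: "\<sigma> permutes {..<p + q}"
    by (rule bij_imp_permutes) (simp add: \<sigma>_def)
  have \<sigma>1: "\<sigma> i = ys ! i" if "i < p" for i
    using that ys by (simp add: \<sigma>_def nth_append)
  have \<sigma>2: "\<sigma> i = zs ! (i - p)" if "p \<le> i" "i < p + q" for i
    using that ys by (simp add: \<sigma>_def nth_append)
  have "strict_mono_on {..<p} \<sigma>"
    using sorted_wrt_nth_less[OF ys(3)] ys(1) by (intro strict_mono_onI) (simp add: \<sigma>1)
  moreover have "strict_mono_on {p..<p + q} \<sigma>"
    using sorted_wrt_nth_less[OF zs(2)] lzs by (intro strict_mono_onI) (simp add: \<sigma>2)
  ultimately have "\<sigma> \<in> shuffle_perms p q"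
    using perm by (simp add: shuffle_perms_def)
  moreover have "A = \<sigma> ` {..<p}"
  proof -
    have "\<sigma> ` {..<p} = (!) ys ` {..<p}"
      by (rule image_cong) (simp_all add: \<sigma>1)
    then show ?thesis
      using ys(1,2) nth_image[of p ys] by (simp add: atLeast0LessThan)
  qed
  ultimately show "A \<in> (\<lambda>\<sigma>. \<sigma> ` {..<p}) ` shuffle_perms p q"
    by blast
qed

text \<open>
  Both sides are sums over the \<open>p\<close>-element subsets of the set of positions, with the same signs. The
  splittings are taken of the list of positions, which is strictly sorted, and then transported to
  \<open>xs\<close>.
\<close>

lemma (in vector_space) sum_shuffle_perms_eq_split_sum:
  assumes "length xs = p + q"
  shows "(\<Sum>\<sigma>\<in>shuffle_perms p q. scale (of_int (sign \<sigma>))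
            (F (map (\<lambda>i. xs ! \<sigma> i) [0..<p]) (map (\<lambda>i. xs ! \<sigma> i) [p..<p + q]))) =
         split_sum (\<lambda>ys zs. if length ys = p then F ys zs else 0) xs"
proof -
  define sl :: "nat set \<Rightarrow> nat list" where "sl = sorted_list_of_set"
  define g where "g = (\<lambda>A. scale (of_int (inversion_sign (sl A @ sl ({..<p + q} - A))))
            (F (map ((!) xs) (sl A)) (map ((!) xs) (sl ({..<p + q} - A)))))"
  have "(\<Sum>\<sigma>\<in>shuffle_perms p q. scale (of_int (sign \<sigma>))
            (F (map (\<lambda>i. xs ! \<sigma> i) [0..<p]) (map (\<lambda>i. xs ! \<sigma> i) [p..<p + q]))) =
        (\<Sum>\<sigma>\<in>shuffle_perms p q. g (\<sigma> ` {..<p}))"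
  proof (intro sum.cong refl)
    fix \<sigma> assume \<sigma>: "\<sigma> \<in> shuffle_perms p q"
    have "sign \<sigma> = inversion_sign (map \<sigma> [0..<p + q])"
      using \<sigma> by (intro sign_eq_inversion_sign) (simp add: shuffle_perms_def)
    also have "map \<sigma> [0..<p + q] = map \<sigma> [0..<p] @ map \<sigma> [p..<p + q]"
      by (simp only: upt_add_eq_append[of 0 p q, simplified] map_append)
    finally have "sign \<sigma> = inversion_sign (sl (\<sigma> ` {..<p}) @ sl ({..<p + q} - \<sigma> ` {..<p}))"
      unfolding shuffle_perms_blocks[OF \<sigma>] sl_def .
    moreover have "map (\<lambda>i. xs ! \<sigma> i) is = map ((!) xs) (map \<sigma> is)" for "is"
      by simp
    ultimately show "scale (of_int (sign \<sigma>))
            (F (map (\<lambda>i. xs ! \<sigma> i) [0..<p]) (map (\<lambda>i. xs ! \<sigma> i) [p..<p + q])) = g (\<sigma> ` {..<p})"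
      unfolding g_def sl_def by (simp only: shuffle_perms_blocks[OF \<sigma>])
  qed
  also have "\<dots> = (\<Sum>A | A \<in> Pow {..<p + q} \<and> card A = p. g A)"
    by (rule sum.reindex_bij_betw[OF bij_betw_shuffle_perms_subsets])
  also have "\<dots> = (\<Sum>A\<in>Pow {..<p + q}. if length (sl A) = p then g A else 0)"
    by (subst sum.inter_filter) (auto intro!: sum.cong simp: sl_def)
  also have "\<dots> = split_sum (\<lambda>ys zs. if length ys = p then F (map ((!) xs) ys) (map ((!) xs) zs) else 0) [0..<p + q]"
  proof -
    have "sorted_wrt (<) [0..<p + q]" "set [0..<p + q] = {..<p + q}"
      by (simp_all add: atLeast0LessThan)
    then show ?thesis
      by (simp only: split_sum_eq_sum_subsets, intro sum.cong refl) (simp add: g_def sl_def)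
  qed
  also have "\<dots> = split_sum (\<lambda>ys zs. if length ys = p then F ys zs else 0) (map ((!) xs) [0..<p + q])"
    by (simp only: split_sum_map length_map)
  also have "map ((!) xs) [0..<p + q] = xs"
    using map_nth[of xs] by (simp only: assms)
  finally show ?thesis .
qed


section \<open>Twisting maps\<close>

locale commuting_linear_bijections = vector_space scale
  for scale :: "complex \<Rightarrow> 'a::ab_group_add \<Rightarrow> 'a" +
  fixes \<alpha> \<beta> :: "'a \<Rightarrow> 'a"
  assumes linear_\<alpha>: "Vector_Spaces.linear scale scale \<alpha>"
    and linear_\<beta>: "Vector_Spaces.linear scale scale \<beta>"
    and commute: "\<alpha> \<circ> \<beta> = \<beta> \<circ> \<alpha>"
    and bij_\<alpha>: "bij \<alpha>"
    and bij_\<beta>: "bij \<beta>"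
begin

abbreviation endo :: "('a \<Rightarrow> 'a) \<Rightarrow> bool" where
  "endo \<equiv> Vector_Spaces.linear scale scale"

lemma endo_iff: "endo g \<longleftrightarrow> (\<forall>x y. g (x + y) = g x + g y) \<and> (\<forall>c x. g (scale c x) = scale c (g x))"
  unfolding Vector_Spaces.linear_iff using vector_space_axioms by simp

lemma endo_additive: "endo g \<Longrightarrow> additive g"
  by unfold_locales (simp add: endo_iff)

lemma endo_compose: "endo g \<Longrightarrow> endo h \<Longrightarrow> endo (\<lambda>x. g (h x))"
  by (simp add: endo_iff)

lemma endo_zero_map: "endo (\<lambda>x. 0)"
  by (simp add: endo_iff)

lemma endo_add: "endo g \<Longrightarrow> endo h \<Longrightarrow> endo (\<lambda>x. g x + h x)"
  by (simp add: endo_iff scale_right_distrib add.assoc add.left_commute)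

lemma endo_scale: "endo g \<Longrightarrow> endo (\<lambda>x. scale c (g x))"
  by (simp add: endo_iff scale_right_distrib mult.commute)

lemma endo_koszul: "endo g \<Longrightarrow> endo (\<lambda>x. koszul n (g x))"
  by (simp add: endo_iff koszul_def)

lemma additive_scale: "additive (scale c)"
  by unfold_locales (rule scale_right_distrib)

lemma bij_\<alpha>\<beta>: "bij (\<alpha> \<circ> \<beta>)"
  by (rule bij_comp[OF bij_\<beta> bij_\<alpha>])

text \<open>
  Uniform in \<open>n\<close>: for \<open>n = 0\<close> the twist is an inverse, otherwise a power, of \<open>\<alpha> \<circ> \<beta>\<close>.
\<close>

lemma twist_commutes:
  assumes "\<And>x. g (\<alpha> (\<beta> x)) = \<alpha> (\<beta> (g x))"
  shows "g (twist \<alpha> \<beta> n x) = twist \<alpha> \<beta> n (g x)"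
proof (cases n)
  case 0
  have t: "\<alpha> (\<beta> (inv (\<alpha> \<circ> \<beta>) y)) = y" for y
    using surj_f_inv_f[OF bij_is_surj[OF bij_\<alpha>\<beta>], of y] by simp
  have "inv (\<alpha> \<circ> \<beta>) ((\<alpha> \<circ> \<beta>) (g (inv (\<alpha> \<circ> \<beta>) x))) = inv (\<alpha> \<circ> \<beta>) (g x)"
    by (simp only: comp_apply assms[symmetric] t)
  then show ?thesis
    by (simp only: twist_def 0 simp_thms if_True inv_f_f[OF bij_is_inj[OF bij_\<alpha>\<beta>]])
next
  case (Suc m)
  have "g (((\<alpha> \<circ> \<beta>) ^^ m) x) = ((\<alpha> \<circ> \<beta>) ^^ m) (g x)"
    by (induction m) (simp_all add: assms)
  with Suc show ?thesis by (simp add: twist_def)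
qed

lemma equivariant_twist:
  assumes "\<And>xs. f (map \<alpha> xs) = \<alpha> (f xs)" "\<And>xs. f (map \<beta> xs) = \<beta> (f xs)"
  shows "f (map (twist \<alpha> \<beta> n) xs) = twist \<alpha> \<beta> n (f xs)"
proof -
  have f: "f (map (\<alpha> \<circ> \<beta>) ys) = (\<alpha> \<circ> \<beta>) (f ys)" for ys
  proof -
    have "f (map \<alpha> (map \<beta> ys)) = \<alpha> (\<beta> (f ys))"
      by (simp only: assms)
    then show ?thesis by (simp add: comp_def)
  qed
  show ?thesis
  proof (cases n)
    case 0
    have "(\<alpha> \<circ> \<beta>) (f (map (inv (\<alpha> \<circ> \<beta>)) xs)) = f xs"
      unfolding f[symmetric] map_map surj_iff[THEN iffD1, OF bij_is_surj[OF bij_\<alpha>\<beta>]] by simp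
    then have "inv (\<alpha> \<circ> \<beta>) (f xs) = f (map (inv (\<alpha> \<circ> \<beta>)) xs)"
      using inv_f_f[OF bij_is_inj[OF bij_\<alpha>\<beta>]] by metis
    with 0 show ?thesis by (simp add: twist_def)
  next
    case (Suc m)
    have "f (map ((\<alpha> \<circ> \<beta>) ^^ m) xs) = ((\<alpha> \<circ> \<beta>) ^^ m) (f xs)" for xs
    proof (induction m)
      case (Suc m)
      have "f (map ((\<alpha> \<circ> \<beta>) ^^ Suc m) xs) = f (map (\<alpha> \<circ> \<beta>) (map ((\<alpha> \<circ> \<beta>) ^^ m) xs))"
        by (simp only: funpow.simps map_map)
      also have "\<dots> = ((\<alpha> \<circ> \<beta>) ^^ Suc m) (f xs)"
        unfolding f Suc by simp
      finally show ?case .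
    qed (simp add: id_def)
    with Suc show ?thesis by (simp add: twist_def)
  qed
qed

lemma \<alpha>_twist: "\<alpha> (twist \<alpha> \<beta> n x) = twist \<alpha> \<beta> n (\<alpha> x)"
  by (rule twist_commutes) (metis commute comp_apply)

lemma \<beta>_twist: "\<beta> (twist \<alpha> \<beta> n x) = twist \<alpha> \<beta> n (\<beta> x)"
  by (rule twist_commutes) (metis commute comp_apply)

lemma twist_twist_commute: "twist \<alpha> \<beta> m (twist \<alpha> \<beta> n x) = twist \<alpha> \<beta> n (twist \<alpha> \<beta> m x)"
  by (rule twist_commutes) (simp only: \<alpha>_twist \<beta>_twist)

text \<open>
  Twists are powers of \<open>\<alpha> \<circ> \<beta>\<close> with exponent one less than the arity, and the exponents add. Since
  one arity has the form \<open>Suc m\<close>, the sum of the exponents is at least \<open>-1\<close>, which is where \<open>twist\<close> starts.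
\<close>

lemma twist_Suc_twist: "twist \<alpha> \<beta> (Suc m) (twist \<alpha> \<beta> n x) = twist \<alpha> \<beta> (m + n) x"
proof (cases n)
  case 0
  have "(\<alpha> \<circ> \<beta>) (inv (\<alpha> \<circ> \<beta>) x) = x"
    by (rule surj_f_inv_f[OF bij_is_surj[OF bij_\<alpha>\<beta>]])
  then have "((\<alpha> \<circ> \<beta>) ^^ Suc k) (inv (\<alpha> \<circ> \<beta>) x) = ((\<alpha> \<circ> \<beta>) ^^ k) x" for k
    unfolding funpow_Suc_right by (simp only: comp_apply[of "(\<alpha> \<circ> \<beta>) ^^ k"])
  with 0 show ?thesis
    by (cases m) (simp_all add: twist_def del: funpow.simps(2))
next
  case (Suc k)
  then show ?thesis by (simp add: twist_def funpow_add)
qed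

lemma endo_twist: "endo (twist \<alpha> \<beta> n)"
proof -
  have "endo (\<lambda>x. \<alpha> (\<beta> x))"
    by (rule endo_compose[OF linear_\<alpha> linear_\<beta>])
  then have t: "\<alpha> (\<beta> (x + y)) = \<alpha> (\<beta> x) + \<alpha> (\<beta> y)" "\<alpha> (\<beta> (scale c x)) = scale c (\<alpha> (\<beta> x))" for c x y
    by (simp_all add: endo_iff)
  have s: "twist \<alpha> \<beta> n (scale c x) = scale c (twist \<alpha> \<beta> n x)" for c x
    by (rule twist_commutes[symmetric]) (rule t(2)[symmetric])
  have inv: "inv (\<alpha> \<circ> \<beta>) (x + y) = inv (\<alpha> \<circ> \<beta>) x + inv (\<alpha> \<circ> \<beta>) y" for x y
  proof -
    have i: "(\<alpha> \<circ> \<beta>) (inv (\<alpha> \<circ> \<beta>) z) = z" for z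
      by (rule surj_f_inv_f[OF bij_is_surj[OF bij_\<alpha>\<beta>]])
    have "(\<alpha> \<circ> \<beta>) (inv (\<alpha> \<circ> \<beta>) x + inv (\<alpha> \<circ> \<beta>) y) = x + y"
      using i[of x] i[of y] by (simp add: t)
    then show ?thesis
      using inv_f_f[OF bij_is_inj[OF bij_\<alpha>\<beta>]] by metis
  qed
  have pow: "((\<alpha> \<circ> \<beta>) ^^ m) (x + y) = ((\<alpha> \<circ> \<beta>) ^^ m) x + ((\<alpha> \<circ> \<beta>) ^^ m) y" for m x y
    by (induction m) (simp_all add: t)
  have "twist \<alpha> \<beta> n (x + y) = twist \<alpha> \<beta> n x + twist \<alpha> \<beta> n y" for x y
    by (simp only: twist_def inv pow split: if_split) simp
  with s show ?thesis by (simp add: endo_iff)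
qed

section \<open>Cochains and their circle product\<close>

text \<open>
  The \<open>(i + 1)\<close>-cochains, for every integer \<open>i\<close>. As the value on lists of any other length is \<open>0\<close>,
  linearity, skew-symmetry and equivariance can be required for all lists, and for \<open>i < -1\<close> only the zero
  map remains.
\<close>

definition cochain :: "int \<Rightarrow> ('a list \<Rightarrow> 'a) \<Rightarrow> bool" where
  "cochain i f \<longleftrightarrow>
     (\<forall>xs. int (length xs) \<noteq> i + 1 \<longrightarrow> f xs = 0) \<and>
     (\<forall>us vs. endo (\<lambda>x. f (us @ x # vs))) \<and>
     alternating f \<and>
     (\<forall>xs. f (map \<alpha> xs) = \<alpha> (f xs)) \<and>
     (\<forall>xs. f (map \<beta> xs) = \<beta> (f xs))"

lemma cochainI:
  assumes "\<And>xs. int (length xs) \<noteq> i + 1 \<Longrightarrow> f xs = 0"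
    and "\<And>us vs. endo (\<lambda>x. f (us @ x # vs))"
    and "alternating f"
    and "\<And>xs. f (map \<alpha> xs) = \<alpha> (f xs)"
    and "\<And>xs. f (map \<beta> xs) = \<beta> (f xs)"
  shows "cochain i f"
  using assms unfolding cochain_def by blast

lemma
  assumes "cochain i f"
  shows cochain_support: "int (length xs) \<noteq> i + 1 \<Longrightarrow> f xs = 0"
    and cochain_endo: "endo (\<lambda>x. f (us @ x # vs))"
    and cochain_alternating: "alternating f"
    and cochain_\<alpha>: "f (map \<alpha> xs) = \<alpha> (f xs)"
    and cochain_\<beta>: "f (map \<beta> xs) = \<beta> (f xs)"
  using assms unfolding cochain_def by blast+

lemma cochain_endo_head: "cochain i f \<Longrightarrow> endo (\<lambda>x. f (x # vs))"
  using cochain_endo[where us = "[]"] by simp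

lemma cochain_additive_head: "cochain i f \<Longrightarrow> additive (\<lambda>x. f (x # vs))"
  by (rule endo_additive[OF cochain_endo_head])

lemma cochain_zero_head: "cochain i f \<Longrightarrow> f (0 # vs) = 0"
  using additive.zero[OF cochain_additive_head] .

lemma endo_split_sum_param:
  assumes "\<And>ys zs. endo (\<lambda>x. G x ys zs)"
  shows "endo (\<lambda>x. split_sum (G x) xs)"
proof -
  have "G (x + y) = (\<lambda>ys zs. G x ys zs + G y ys zs)" "G (scale c x) = (\<lambda>ys zs. scale c (G x ys zs))" for x y c
    using assms by (simp_all add: endo_iff fun_eq_iff)
  then show ?thesis
    by (simp add: endo_iff split_sum_add split_sum_hom[OF additive_scale])
qed

lemma endo_split_sum:
  assumes "\<And>zs us vs. endo (\<lambda>x. F (us @ x # vs) zs)" and "\<And>ys us vs. endo (\<lambda>x. F ys (us @ x # vs))"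
  shows "endo (\<lambda>x. split_sum F (us @ x # vs))"
  using assms
proof (induction us arbitrary: F)
  case Nil
  have "endo (\<lambda>x. split_sum (\<lambda>ys zs. F (x # ys) zs) vs)"
    using Nil(1)[where us = "[]"] by (intro endo_split_sum_param) simp
  moreover have "endo (\<lambda>x. split_sum (\<lambda>ys zs. koszul (int (length ys)) (F ys (x # zs))) vs)"
    using Nil(2)[where us = "[]"] by (intro endo_split_sum_param endo_koszul) simp
  ultimately show ?case
    by (simp add: endo_add)
next
  case (Cons u us)
  have "endo (\<lambda>x. split_sum (\<lambda>ys zs. F (u # ys) zs) (us @ x # vs))"
    using Cons.prems(1)[where us = "u # _"] Cons.prems(2) by (intro Cons.IH) simp_all
  moreover have "endo (\<lambda>x. split_sum (\<lambda>ys zs. koszul (int (length ys)) (F ys (u # zs))) (us @ x # vs))"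
    using Cons.prems(1) Cons.prems(2)[where us = "u # _"] by (intro Cons.IH) (simp_all add: endo_koszul)
  ultimately show ?case
    by (simp add: endo_add)
qed

text \<open>
  The circle product without arities: the twist is read off from the number of arguments that \<open>L\<close>
  receives, and for a cochain \<open>L\<close> all other splittings contribute \<open>K (0 # _) = 0\<close>.
\<close>

definition circ :: "('a list \<Rightarrow> 'a) \<Rightarrow> ('a list \<Rightarrow> 'a) \<Rightarrow> 'a list \<Rightarrow> 'a" (infixl "\<star>" 70) where
  "K \<star> L = split_sum (\<lambda>ys zs. K (L ys # map (twist \<alpha> \<beta> (length ys)) zs))"

lemma circ_equivariant:
  assumes "additive g" "\<And>n x. g (twist \<alpha> \<beta> n x) = twist \<alpha> \<beta> n (g x)"
    and "\<And>xs. K (map g xs) = g (K xs)" "\<And>xs. L (map g xs) = g (L xs)"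
  shows "(K \<star> L) (map g xs) = g ((K \<star> L) xs)"
proof -
  have "K (L (map g ys) # map (twist \<alpha> \<beta> (length (map g ys))) (map g zs)) =
      g (K (L ys # map (twist \<alpha> \<beta> (length ys)) zs))" for ys zs
  proof -
    have "L (map g ys) # map (twist \<alpha> \<beta> (length (map g ys))) (map g zs) =
        map g (L ys # map (twist \<alpha> \<beta> (length ys)) zs)"
      by (simp add: assms(2,4))
    then show ?thesis by (simp only: assms(3))
  qed
  then show ?thesis
    unfolding circ_def split_sum_map split_sum_hom[OF assms(1), symmetric] by simp
qed

lemma cochain_circ:
  assumes K: "cochain i K" and L: "cochain j L"
  shows "cochain (i + j) (K \<star> L)"
proof (rule cochainI)
  fix xs :: "'a list"
  assume len: "int (length xs) \<noteq> i + j + 1"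
  have "(K \<star> L) xs = split_sum (\<lambda>ys zs. 0) xs"
    unfolding circ_def
  proof (rule split_sum_cong)
    fix ys zs :: "'a list"
    assume yz: "length ys + length zs = length xs"
    show "K (L ys # map (twist \<alpha> \<beta> (length ys)) zs) = 0"
    proof (cases "int (length ys) = j + 1")
      case True
      with len yz show ?thesis by (intro cochain_support[OF K]) auto
    next
      case False
      then show ?thesis by (simp add: cochain_support[OF L] cochain_zero_head[OF K])
    qed
  qed
  then show "(K \<star> L) xs = 0" by simp
next
  fix us vs
  show "endo (\<lambda>x. (K \<star> L) (us @ x # vs))"
    unfolding circ_def
  proof (rule endo_split_sum)
    fix zs us vs
    show "endo (\<lambda>x. K (L (us @ x # vs) # map (twist \<alpha> \<beta> (length (us @ x # vs))) zs))"
      using endo_compose[OF cochain_endo_head[OF K] cochain_endo[OF L]] by simp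
  next
    fix ys us vs
    show "endo (\<lambda>x. K (L ys # map (twist \<alpha> \<beta> (length ys)) (us @ x # vs)))"
      using endo_compose[OF cochain_endo[OF K, where us = "L ys # map (twist \<alpha> \<beta> (length ys)) us"] endo_twist]
      by simp
  qed
next
  show "alternating (K \<star> L)"
    unfolding circ_def
  proof (rule split_sum_alternating)
    fix zs
    show "alternating (\<lambda>ys. K (L ys # map (twist \<alpha> \<beta> (length ys)) zs))"
      unfolding alternating_def
    proof (intro allI)
      fix us x y vs
      show "K (L (us @ x # y # vs) # map (twist \<alpha> \<beta> (length (us @ x # y # vs))) zs) =
          - K (L (us @ y # x # vs) # map (twist \<alpha> \<beta> (length (us @ y # x # vs))) zs)"
        unfolding alternatingD[OF cochain_alternating[OF L], of us x y vs]
        by (simp add: additive.minus[OF cochain_additive_head[OF K]])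
    qed
  next
    fix ys
    show "alternating (\<lambda>zs. K (L ys # map (twist \<alpha> \<beta> (length ys)) zs))"
      unfolding alternating_def
      using alternatingD[OF cochain_alternating[OF K], where us = "L ys # map (twist \<alpha> \<beta> (length ys)) us" for us]
      by (metis append_Cons list.simps(9) map_append)
  qed
next
  show "(K \<star> L) (map \<alpha> xs) = \<alpha> ((K \<star> L) xs)" for xs
    by (intro circ_equivariant endo_additive linear_\<alpha> \<alpha>_twist cochain_\<alpha>[OF K] cochain_\<alpha>[OF L])
  show "(K \<star> L) (map \<beta> xs) = \<beta> ((K \<star> L) xs)" for xs
    by (intro circ_equivariant endo_additive linear_\<beta> \<beta>_twist cochain_\<beta>[OF K] cochain_\<beta>[OF L])
qed

lemma circ_add_left: "(K + K') \<star> L = K \<star> L + K' \<star> L"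
  by (simp add: circ_def fun_eq_iff split_sum_add)

lemma circ_scale_left: "pointwise_scale scale c K \<star> L = pointwise_scale scale c (K \<star> L)"
  by (simp add: circ_def fun_eq_iff pointwise_scale_def split_sum_hom[OF additive_scale])

lemma circ_koszul_left: "koszul n K \<star> L = koszul n (K \<star> L)"
  by (simp add: circ_def fun_eq_iff koszul_def split_sum_minus)

lemma circ_diff_left: "(K - K') \<star> L = K \<star> L - K' \<star> L"
  using circ_add_left[of "K - K'" K' L] by (simp add: algebra_simps)

lemma circ_add_right: "cochain i K \<Longrightarrow> K \<star> (L + L') = K \<star> L + K \<star> L'"
  by (simp add: circ_def fun_eq_iff split_sum_add additive.add[OF cochain_additive_head])

lemma circ_scale_right:
  assumes "cochain i K"
  shows "K \<star> pointwise_scale scale c L = pointwise_scale scale c (K \<star> L)"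
proof -
  have "K (scale c x # zs) = scale c (K (x # zs))" for x zs
    using cochain_endo_head[OF assms] by (simp add: endo_iff)
  then show ?thesis
    by (simp add: circ_def fun_eq_iff pointwise_scale_def split_sum_hom[OF additive_scale])
qed

lemma circ_diff_right: "cochain i K \<Longrightarrow> K \<star> (L - L') = K \<star> L - K \<star> L'"
  using circ_add_right[of i K "L - L'" L'] by (simp add: algebra_simps)

lemma circ_koszul_right: "cochain i K \<Longrightarrow> K \<star> koszul n L = koszul n (K \<star> L)"
  using circ_diff_right[of i K 0 L] circ_diff_right[of i K 0 0] by (simp add: koszul_def)

section \<open>The graded pre-Lie identity\<close>

text \<open>
  The sum in which \<open>L\<close> and \<open>M\<close> fill two different arguments of \<open>K\<close>. The sign accounts for moving
  \<open>M as\<close> past the arguments \<open>bs\<close> of \<open>L\<close>.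
\<close>

definition side_by_side :: "('a list \<Rightarrow> 'a) \<Rightarrow> ('a list \<Rightarrow> 'a) \<Rightarrow> ('a list \<Rightarrow> 'a) \<Rightarrow> 'a list \<Rightarrow> 'a" where
  "side_by_side K L M = split_sum (\<lambda>cs zs. split_sum (\<lambda>as bs. koszul (int (length bs))
     (K (twist \<alpha> \<beta> (length as) (L bs) # twist \<alpha> \<beta> (length bs) (M as) #
         map (\<lambda>z. twist \<alpha> \<beta> (length bs) (twist \<alpha> \<beta> (length as) z)) zs))) cs)"

text \<open>
  In \<open>(K \<star> L) \<star> M\<close> the head \<open>M as\<close> of the argument list of \<open>K \<star> L\<close> goes either to \<open>L\<close> or to \<open>K\<close>,
  according to the two branches of the recursion of \<open>split_sum\<close>. The first case gives \<open>K \<star> (L \<star> M)\<close>; in the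
  second, equivariance moves the twist out of \<open>L\<close>.
\<close>

lemma associator_eq_side_by_side:
  assumes K: "cochain i K" and L: "cochain j L"
  shows "(K \<star> L) \<star> M = K \<star> (L \<star> M) + side_by_side K L M"
proof
  fix xs
  have "((K \<star> L) \<star> M) xs = split_sum (\<lambda>as cs. (K \<star> L) (M as # map (twist \<alpha> \<beta> (length as)) cs)) xs"
    by (simp add: circ_def)
  also have "\<dots> = split_sum (\<lambda>as cs. split_sum (\<lambda>bs zs.
        K (L (M as # map (twist \<alpha> \<beta> (length as)) bs) # map (twist \<alpha> \<beta> (length bs + length as)) zs)) cs) xs +
      split_sum (\<lambda>as cs. split_sum (\<lambda>bs zs. koszul (int (length bs))
        (K (L (map (twist \<alpha> \<beta> (length as)) bs) # twist \<alpha> \<beta> (length bs) (M as) #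
          map (\<lambda>z. twist \<alpha> \<beta> (length bs) (twist \<alpha> \<beta> (length as) z)) zs))) cs) xs"
    by (simp add: circ_def split_sum_map split_sum_add o_def twist_Suc_twist)
  also have "split_sum (\<lambda>as cs. split_sum (\<lambda>bs zs. koszul (int (length bs))
        (K (L (map (twist \<alpha> \<beta> (length as)) bs) # twist \<alpha> \<beta> (length bs) (M as) #
          map (\<lambda>z. twist \<alpha> \<beta> (length bs) (twist \<alpha> \<beta> (length as) z)) zs))) cs) xs = side_by_side K L M xs"
    unfolding side_by_side_def split_sum_coassoc equivariant_twist[of L, OF cochain_\<alpha>[OF L] cochain_\<beta>[OF L]] ..
  also have "split_sum (\<lambda>as cs. split_sum (\<lambda>bs zs.
        K (L (M as # map (twist \<alpha> \<beta> (length as)) bs) # map (twist \<alpha> \<beta> (length bs + length as)) zs)) cs) xs =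
      split_sum (\<lambda>cs zs. split_sum (\<lambda>as bs.
        K (L (M as # map (twist \<alpha> \<beta> (length as)) bs) # map (twist \<alpha> \<beta> (length bs + length as)) zs)) cs) xs"
    by (rule split_sum_coassoc)
  also have "\<dots> = split_sum (\<lambda>cs zs. split_sum (\<lambda>as bs.
        K (L (M as # map (twist \<alpha> \<beta> (length as)) bs) # map (twist \<alpha> \<beta> (length cs)) zs)) cs) xs"
    by (intro split_sum_cong) (metis add.commute)
  also have "\<dots> = (K \<star> (L \<star> M)) xs"
    unfolding circ_def by (simp only: split_sum_hom[OF cochain_additive_head[OF K]])
  finally show "((K \<star> L) \<star> M) xs = (K \<star> (L \<star> M) + side_by_side K L M) xs"
    by simp
qed

text \<open>
  Exchanging the parts \<open>as\<close> and \<open>bs\<close> costs \<open>(j + 1) * (k + 1)\<close> signs, exchanging the first two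
  arguments of \<open>K\<close> costs one, and the sign in the definition changes from \<open>k + 1\<close> to \<open>j + 1\<close>. Modulo \<open>2\<close>
  the total is \<open>j * k\<close>.
\<close>

lemma side_by_side_symmetric:
  assumes K: "cochain i K" and L: "cochain j L" and M: "cochain k M"
  shows "side_by_side K L M = koszul (j * k) (side_by_side K M L)"
proof
  fix xs
  define G where "G = (\<lambda>as bs zs. K (twist \<alpha> \<beta> (length bs) (M as) # twist \<alpha> \<beta> (length as) (L bs) #
    map (\<lambda>z. twist \<alpha> \<beta> (length as) (twist \<alpha> \<beta> (length bs) z)) zs))"
  \<comment> \<open>the skew-symmetry of \<open>K\<close> in its first two arguments puts the value of \<open>M\<close> first, as in the sum for \<open>K M L\<close>\<close>
  have flip: "K (twist \<alpha> \<beta> (length as) (L bs) # twist \<alpha> \<beta> (length bs) (M as) #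
         map (\<lambda>z. twist \<alpha> \<beta> (length bs) (twist \<alpha> \<beta> (length as) z)) zs) = - G as bs zs" for as bs zs
    unfolding G_def twist_twist_commute[of "length bs" "length as"]
    using alternatingD[OF cochain_alternating[OF K], of "[]" "twist \<alpha> \<beta> (length as) (L bs)"] by simp
  \<comment> \<open>only these lengths contribute, so the lengths in the signs may be replaced by degrees\<close>
  have zero: "G as bs zs = 0" if "int (length as) \<noteq> k + 1 \<or> int (length bs) \<noteq> j + 1" for as bs zs
  proof -
    have t0: "twist \<alpha> \<beta> n 0 = 0" for n
      by (rule additive.zero[OF endo_additive[OF endo_twist]])
    show ?thesis
    proof (cases "int (length as) \<noteq> k + 1")
      case True
      then show ?thesis
        by (simp add: G_def cochain_support[OF M] t0 cochain_zero_head[OF K])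
    next
      case False
      with that have "L bs = 0" by (intro cochain_support[OF L]) simp
      then show ?thesis
        using additive.zero[OF endo_additive[OF cochain_endo[OF K, where us = "[_]"]]]
        by (simp add: G_def t0)
    qed
  qed
  have "side_by_side K L M xs = split_sum (\<lambda>cs zs. split_sum (\<lambda>as bs. koszul (int (length bs)) (- G as bs zs)) cs) xs"
    unfolding side_by_side_def flip ..
  also have "\<dots> = split_sum (\<lambda>cs zs. split_sum (\<lambda>as bs. koszul (int (length as) * int (length bs))
      (koszul (int (length as)) (- G bs as zs))) cs) xs"
    by (subst split_sum_cocomm) (rule refl)
  also have "\<dots> = split_sum (\<lambda>cs zs. split_sum (\<lambda>as bs. koszul (j * k) (koszul (int (length bs)) (G bs as zs))) cs) xs"
  proof (intro split_sum_cong)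
    fix as bs zs :: "'a list"
    show "koszul (int (length as) * int (length bs)) (koszul (int (length as)) (- G bs as zs)) =
        koszul (j * k) (koszul (int (length bs)) (G bs as zs))"
    proof (cases "int (length as) = j + 1 \<and> int (length bs) = k + 1")
      case True
      then show ?thesis by (auto simp: koszul_def)
    next
      case False
      then show ?thesis by (subst (1 2) zero) auto
    qed
  qed
  also have "\<dots> = koszul (j * k) (side_by_side K M L xs)"
    unfolding side_by_side_def G_def split_sum_koszul ..
  finally show "side_by_side K L M xs = koszul (j * k) (side_by_side K M L) xs"
    by (simp add: koszul_def)
qed

lemma circ_graded_pre_Lie:
  assumes "cochain i K" and "cochain j L" and "cochain k M"
  shows "(K \<star> L) \<star> M - K \<star> (L \<star> M) = koszul (j * k) ((K \<star> M) \<star> L - K \<star> (M \<star> L))"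
  using side_by_side_symmetric[OF assms] associator_eq_side_by_side[OF assms(1,2)]
    associator_eq_side_by_side[OF assms(1,3)] by simp

section \<open>The graded commutator\<close>

text \<open>
  The degrees enter only through the parity \<open>e\<close> of their product, which keeps the bracket bilinear.
\<close>

definition bracket :: "int \<Rightarrow> ('a list \<Rightarrow> 'a) \<Rightarrow> ('a list \<Rightarrow> 'a) \<Rightarrow> 'a list \<Rightarrow> 'a" where
  "bracket e K L = K \<star> L - koszul e (L \<star> K)"

lemma bracket_graded_skew: "bracket e K L = - koszul e (bracket e L K)"
  by (simp add: bracket_def koszul_def)

text \<open>
  After expansion, three instances of the pre-Lie identity express \<open>(K \<star> L) \<star> M\<close>, \<open>(L \<star> K) \<star> M\<close> and
  \<open>(M \<star> K) \<star> L\<close> by the nine other triple products, and for each parity of the degrees everything cancels.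
\<close>

lemma bracket_graded_Jacobi:
  assumes K: "cochain i K" and L: "cochain j L" and M: "cochain k M"
  shows "bracket (i * (j + k)) K (bracket (j * k) L M) =
    bracket ((i + j) * k) (bracket (i * j) K L) M +
    koszul (i * j) (bracket (j * (i + k)) L (bracket (i * k) K M))"
proof -
  have KLM: "(K \<star> L) \<star> M = K \<star> (L \<star> M) + koszul (j * k) ((K \<star> M) \<star> L - K \<star> (M \<star> L))"
    using circ_graded_pre_Lie[OF K L M] by (simp add: algebra_simps)
  have LKM: "(L \<star> K) \<star> M = L \<star> (K \<star> M) + koszul (i * k) ((L \<star> M) \<star> K - L \<star> (M \<star> K))"
    using circ_graded_pre_Lie[OF L K M] by (simp add: algebra_simps)
  have MKL: "(M \<star> K) \<star> L = M \<star> (K \<star> L) + koszul (i * j) ((M \<star> L) \<star> K - M \<star> (L \<star> K))"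
    using circ_graded_pre_Lie[OF M K L] by (simp add: algebra_simps)
  note expand = circ_diff_left circ_koszul_left circ_diff_right[OF K] circ_diff_right[OF L] circ_diff_right[OF M]
    circ_koszul_right[OF K] circ_koszul_right[OF L] circ_koszul_right[OF M]
  show ?thesis
    unfolding bracket_def expand KLM LKM MKL
    by (cases "even i"; cases "even j"; cases "even k") (simp_all add: koszul_def)
qed

end


section \<open>The bracket of the direct sum\<close>

context commuting_linear_bijections
begin

lemma cochain_zero: "cochain i 0"
  by (intro cochainI)
    (auto simp: endo_zero_map alternating_def additive.zero[OF endo_additive[OF linear_\<alpha>]]
      additive.zero[OF endo_additive[OF linear_\<beta>]])

lemma cochain_add:
  assumes f: "cochain i f" and g: "cochain i g"
  shows "cochain i (f + g)"
proof (rule cochainI)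
  show "endo (\<lambda>x. (f + g) (us @ x # vs))" for us vs
    using endo_add[OF cochain_endo[OF f] cochain_endo[OF g]] by simp
  show "alternating (f + g)"
    unfolding alternating_def
  proof (intro allI)
    fix us x y vs
    show "(f + g) (us @ x # y # vs) = - (f + g) (us @ y # x # vs)"
      using alternatingD[OF cochain_alternating[OF f], of us x y vs]
        alternatingD[OF cochain_alternating[OF g], of us x y vs] by simp
  qed
qed (use linear_\<alpha> linear_\<beta> in \<open>simp_all add: cochain_support[OF f] cochain_support[OF g]
      cochain_\<alpha>[OF f] cochain_\<alpha>[OF g] cochain_\<beta>[OF f] cochain_\<beta>[OF g] endo_iff\<close>)

lemma cochain_scale:
  assumes f: "cochain i f"
  shows "cochain i (pointwise_scale scale c f)"
proof (rule cochainI)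
  show "endo (\<lambda>x. pointwise_scale scale c f (us @ x # vs))" for us vs
    using endo_scale[OF cochain_endo[OF f]] by (simp add: pointwise_scale_def)
  show "alternating (pointwise_scale scale c f)"
    unfolding alternating_def
  proof (intro allI)
    fix us x y vs
    show "pointwise_scale scale c f (us @ x # y # vs) = - pointwise_scale scale c f (us @ y # x # vs)"
      using alternatingD[OF cochain_alternating[OF f], of us x y vs] by (simp add: pointwise_scale_def)
  qed
qed (use linear_\<alpha> linear_\<beta> in \<open>simp_all add: cochain_support[OF f] pointwise_scale_def
      cochain_\<alpha>[OF f] cochain_\<beta>[OF f] endo_iff\<close>)

text \<open>
  The two notions differ in the lists they quantify over and in the use of all permutations or just
  adjacent exchanges. On lists of length other than \<open>n\<close> every condition reads \<open>0 = 0\<close>.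
\<close>

lemma bihom_cochains_iff: "f \<in> bihom_cochains scale \<alpha> \<beta> n \<longleftrightarrow> cochain (int n - 1) f"
proof
  assume "f \<in> bihom_cochains scale \<alpha> \<beta> n"
  then have supp: "\<And>xs. length xs \<noteq> n \<Longrightarrow> f xs = 0"
    and lin: "\<And>xs i. length xs = n \<Longrightarrow> i < n \<Longrightarrow> endo (\<lambda>x. f (xs[i := x]))"
    and skew: "\<And>xs \<sigma>. length xs = n \<Longrightarrow> \<sigma> permutes {..<n} \<Longrightarrow>
      f (permute_list \<sigma> xs) = scale (of_int (sign \<sigma>)) (f xs)"
    and eq: "\<And>xs. length xs = n \<Longrightarrow> f (map \<alpha> xs) = \<alpha> (f xs)" "\<And>xs. length xs = n \<Longrightarrow> f (map \<beta> xs) = \<beta> (f xs)"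
    unfolding bihom_cochains_def multilinear_map_def skew_symmetric_map_def by blast+
  show "cochain (int n - 1) f"
  proof (rule cochainI)
    show "f xs = 0" if "int (length xs) \<noteq> int n - 1 + 1" for xs
      using that by (intro supp) simp
    show "endo (\<lambda>x. f (us @ x # vs))" for us vs
    proof (cases "length (us @ 0 # vs) = n")
      case True
      then have "endo (\<lambda>x. f ((us @ 0 # vs)[length us := x]))"
        by (intro lin) auto
      then show ?thesis by simp
    next
      case False
      then have "f (us @ x # vs) = 0" for x
        by (intro supp) simp
      then show ?thesis by (simp add: endo_zero_map)
    qed
    show "alternating f"
      unfolding alternating_def
    proof (intro allI)
      fix us x y vs
      show "f (us @ x # y # vs) = - f (us @ y # x # vs)"
      proof (cases "length (us @ y # x # vs) = n")
        case True
        then have "Transposition.transpose (length us) (Suc (length us)) permutes {..<n}"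
          by (intro permutes_swap_id) auto
        from skew[OF True this] show ?thesis
          unfolding permute_list_adjacent_transpose by (simp add: sign_swap_id)
      next
        case False
        then show ?thesis using supp[of "us @ x # y # vs"] supp[of "us @ y # x # vs"] by simp
      qed
    qed
    show "f (map \<alpha> xs) = \<alpha> (f xs)" for xs
      using eq(1)[of xs] supp[of xs] supp[of "map \<alpha> xs"] additive.zero[OF endo_additive[OF linear_\<alpha>]]
      by (cases "length xs = n") simp_all
    show "f (map \<beta> xs) = \<beta> (f xs)" for xs
      using eq(2)[of xs] supp[of xs] supp[of "map \<beta> xs"] additive.zero[OF endo_additive[OF linear_\<beta>]]
      by (cases "length xs = n") simp_all
  qed
next
  assume f: "cochain (int n - 1) f"
  have "endo (\<lambda>x. f (xs[i := x]))" if "i < length xs" for xs i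
    using cochain_endo[OF f] that by (simp add: upd_conv_take_nth_drop)
  moreover have "f (permute_list \<sigma> xs) = scale (of_int (sign \<sigma>)) (f xs)" if "\<sigma> permutes {..<length xs}" for \<sigma> xs
    using alternating_permute_list[OF cochain_alternating[OF f] that] by (cases \<sigma> rule: sign_cases) simp_all
  ultimately show "f \<in> bihom_cochains scale \<alpha> \<beta> n"
    unfolding bihom_cochains_def multilinear_map_def skew_symmetric_map_def
    using cochain_support[OF f] cochain_\<alpha>[OF f] cochain_\<beta>[OF f] by auto
qed

lemma bihom_cochains_of_degree_eq: "bihom_cochains_of_degree scale \<alpha> \<beta> i = {f. cochain i f}"
proof (cases "i \<ge> -1")
  case True
  then show ?thesis by (auto simp: bihom_cochains_of_degree_def bihom_cochains_iff)
next
  case False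
  then have "f = 0" if "cochain i f" for f
    using cochain_support[OF that] by (auto simp: fun_eq_iff)
  with False show ?thesis by (auto simp: bihom_cochains_of_degree_def cochain_zero)
qed

text \<open>
  For \<open>k = 0\<close> both sides vanish, since \<open>K\<close> is applied to nonempty lists only.
\<close>

lemma circle_product_eq_circ:
  assumes K: "cochain (int k - 1) K" and L: "cochain (int l - 1) L"
  shows "circle_product scale \<alpha> \<beta> k l K L = K \<star> L"
proof
  fix xs
  show "circle_product scale \<alpha> \<beta> k l K L xs = (K \<star> L) xs"
  proof (cases "k = 0 \<or> length xs \<noteq> k + l - 1")
    case True
    have "(K \<star> L) xs = 0"
    proof (cases "k = 0")
      case True
      then have "K (y # zs) = 0" for y zs
        by (intro cochain_support[OF K]) simp
      then show ?thesis by (simp add: circ_def)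
    next
      case False
      with True show ?thesis
        by (intro cochain_support[OF cochain_circ[OF K L]]) auto
    qed
    with True show ?thesis by (simp add: circle_product_def)
  next
    case False
    then have len: "length xs = l + (k - 1)"
      by simp_all
    have "circle_product scale \<alpha> \<beta> k l K L xs = (\<Sum>\<sigma>\<in>shuffle_perms l (k - 1). scale (of_int (sign \<sigma>))
        ((\<lambda>ys zs. K (L ys # map (twist \<alpha> \<beta> l) zs))
          (map (\<lambda>i. xs ! \<sigma> i) [0..<l]) (map (\<lambda>i. xs ! \<sigma> i) [l..<l + (k - 1)])))"
      using False by (simp add: circle_product_def o_def add.commute[of k l])
    also have "\<dots> = split_sum (\<lambda>ys zs. if length ys = l then K (L ys # map (twist \<alpha> \<beta> l) zs) else 0) xs"
      by (rule sum_shuffle_perms_eq_split_sum[OF len])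
    also have "\<dots> = (K \<star> L) xs"
      unfolding circ_def
    proof (rule split_sum_cong)
      fix ys zs :: "'a list"
      show "(if length ys = l then K (L ys # map (twist \<alpha> \<beta> l) zs) else 0) =
          K (L ys # map (twist \<alpha> \<beta> (length ys)) zs)"
        using cochain_support[OF L, of ys] cochain_zero_head[OF K] by simp
    qed
    finally show ?thesis .
  qed
qed

lemma pointwise_scale_minus_one_powi: "pointwise_scale scale ((-1) powi e) f = koszul e f"
  by (auto simp: pointwise_scale_def koszul_def fun_eq_iff power_int_minus_left)

lemma fn_bracket_homogeneous_eq_bracket:
  assumes "cochain (int k - 1) K" and "cochain (int l - 1) L"
  shows "fn_bracket_homogeneous scale \<alpha> \<beta> k l K L = bracket ((int k - 1) * (int l - 1)) K L"
  by (simp add: fn_bracket_homogeneous_def bracket_def pointwise_scale_minus_one_powi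
      circle_product_eq_circ[OF assms] circle_product_eq_circ[OF assms(2,1)])

lemma bracket_add_left: "cochain j L \<Longrightarrow> bracket e (K + K') L = bracket e K L + bracket e K' L"
  by (simp add: bracket_def circ_add_left circ_add_right koszul_add)

lemma bracket_add_right: "cochain i K \<Longrightarrow> bracket e K (L + L') = bracket e K L + bracket e K L'"
  by (simp add: bracket_def circ_add_left circ_add_right koszul_add)

lemma pointwise_scale_apply: "pointwise_scale scale c f xs = scale c (f xs)"
  by (simp add: pointwise_scale_def)

lemma koszul_pointwise_scale: "koszul e (pointwise_scale scale c f) = pointwise_scale scale c (koszul e f)"
  by (simp add: koszul_def pointwise_scale_def fun_eq_iff)

lemma pointwise_scale_diff: "pointwise_scale scale c (f - g) = pointwise_scale scale c f - pointwise_scale scale c g"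
  by (simp add: pointwise_scale_def fun_eq_iff scale_right_diff_distrib)

lemma bracket_scale_left:
  "cochain j L \<Longrightarrow> bracket e (pointwise_scale scale c K) L = pointwise_scale scale c (bracket e K L)"
  by (simp add: bracket_def circ_scale_left circ_scale_right koszul_pointwise_scale pointwise_scale_diff)

lemma bracket_scale_right:
  "cochain i K \<Longrightarrow> bracket e K (pointwise_scale scale c L) = pointwise_scale scale c (bracket e K L)"
  by (simp add: bracket_def circ_scale_left circ_scale_right koszul_pointwise_scale pointwise_scale_diff)

lemma bracket_zero_left: "cochain j L \<Longrightarrow> bracket e 0 L = 0"
  using bracket_add_left[of j L e 0 0] by simp

lemma bracket_zero_right: "cochain i K \<Longrightarrow> bracket e K 0 = 0"
  using bracket_add_right[of i K e 0 0] by simp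

lemma cochain_bracket:
  assumes "cochain i K" and "cochain j L"
  shows "cochain (i + j) (bracket e K L)"
proof -
  have "bracket e K L = K \<star> L + pointwise_scale scale (- ((-1) powi e)) (L \<star> K)"
    by (simp add: bracket_def pointwise_scale_def fun_eq_iff flip: pointwise_scale_minus_one_powi)
  moreover have "cochain (i + j) (L \<star> K)"
    using cochain_circ[OF assms(2,1)] by (simp add: add.commute)
  ultimately show ?thesis
    using cochain_circ[OF assms] by (simp add: cochain_add cochain_scale)
qed

lemma arity_part_add: "arity_part n (F + G) = arity_part n F + arity_part n G"
  for F G :: "'a list \<Rightarrow> 'a"
  by (simp add: arity_part_def fun_eq_iff)

lemma arity_part_scale: "arity_part n (pointwise_scale scale c F) = pointwise_scale scale c (arity_part n F)"
  by (simp add: arity_part_def pointwise_scale_def fun_eq_iff)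

lemma arity_part_cochain: "cochain i f \<Longrightarrow> arity_part n f = (if int n = i + 1 then f else 0)"
  using cochain_support by (fastforce simp: arity_part_def fun_eq_iff)

lemma total_arity_part:
  "F \<in> bihom_cochains_total scale \<alpha> \<beta> \<Longrightarrow> cochain (int n - 1) (arity_part n F)"
  by (simp add: bihom_cochains_total_def bihom_cochains_iff)

lemma cochain_in_total:
  assumes "cochain i f"
  shows "f \<in> bihom_cochains_total scale \<alpha> \<beta>"
proof -
  have "cochain (int n - 1) (arity_part n f)" for n
    using assms by (auto simp: arity_part_cochain[OF assms] cochain_zero)
  moreover have "{n. arity_part n f \<noteq> 0} \<subseteq> {nat (i + 1)}"
    by (auto simp: arity_part_cochain[OF assms] split: if_splits)
  ultimately show ?thesis
    by (auto simp: bihom_cochains_total_def bihom_cochains_iff intro: finite_subset)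
qed

lemma fn_bracket_total:
  assumes "F \<in> bihom_cochains_total scale \<alpha> \<beta>" "G \<in> bihom_cochains_total scale \<alpha> \<beta>"
  shows "fn_bracket scale \<alpha> \<beta> F G xs = (\<Sum>(k, l) \<in> {(k, l). k + l = length xs + 1}.
    bracket ((int k - 1) * (int l - 1)) (arity_part k F) (arity_part l G) xs)"
  unfolding fn_bracket_def
  by (simp add: fn_bracket_homogeneous_eq_bracket[OF total_arity_part[OF assms(1)] total_arity_part[OF assms(2)]])

text \<open>
  Of the arity parts only those of arities \<open>i + 1\<close> and \<open>j + 1\<close> survive. The sum contains this pair
  exactly when both arities are natural numbers and the number of arguments is \<open>i + j + 1\<close>; in all
  other cases the bracket vanishes as well.
\<close>

lemma fn_bracket_cochains:
  assumes f: "cochain i f" and g: "cochain j g"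
  shows "fn_bracket scale \<alpha> \<beta> f g = bracket (i * j) f g"
proof
  fix xs :: "'a list"
  define S where "S = {(k, l). k + l = length xs + 1}"
  have "S \<subseteq> {..length xs + 1} \<times> {..length xs + 1}"
    by (auto simp: S_def)
  then have fin: "finite S"
    by (rule finite_subset) simp
  have "fn_bracket scale \<alpha> \<beta> f g xs =
      (\<Sum>p\<in>S. if p = (nat (i + 1), nat (j + 1)) then bracket (i * j) f g xs else 0)"
    unfolding fn_bracket_total[OF cochain_in_total[OF f] cochain_in_total[OF g]] S_def[symmetric]
  proof (intro sum.cong refl)
    fix p assume "p \<in> S"
    obtain k l where p: "p = (k, l)" by (cases p)
    have "bracket ((int k - 1) * (int l - 1)) (arity_part k f) (arity_part l g) =
        (if int k = i + 1 \<and> int l = j + 1 then bracket (i * j) f g else 0)"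
      by (auto simp: arity_part_cochain[OF f] arity_part_cochain[OF g] bracket_zero_left[OF g]
          bracket_zero_right[OF f] bracket_zero_right[OF cochain_zero])
    moreover have "bracket (i * j) f g = 0" if "i < -1 \<or> j < -1"
    proof -
      have "f = 0 \<or> g = 0"
        using that cochain_support[OF f] cochain_support[OF g] by (fastforce simp: fun_eq_iff)
      then show ?thesis
        using bracket_zero_left[OF g] bracket_zero_right[OF f] by auto
    qed
    ultimately show "(case p of (k, l) \<Rightarrow> bracket ((int k - 1) * (int l - 1)) (arity_part k f) (arity_part l g) xs) =
        (if p = (nat (i + 1), nat (j + 1)) then bracket (i * j) f g xs else 0)"
      unfolding p by (cases "i < -1 \<or> j < -1") auto
  qed
  also have "\<dots> = (if (nat (i + 1), nat (j + 1)) \<in> S then bracket (i * j) f g xs else 0)"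
    using fin by (rule sum.delta)
  also have "\<dots> = bracket (i * j) f g xs"
  proof (cases "i < -1 \<or> j < -1 \<or> int (length xs) \<noteq> i + j + 1")
    case True
    then have "f = 0 \<or> g = 0 \<or> bracket (i * j) f g xs = 0"
      using cochain_support[OF f] cochain_support[OF g] cochain_support[OF cochain_bracket[OF f g], of xs]
      by (fastforce simp: fun_eq_iff)
    then have "bracket (i * j) f g xs = 0"
      using bracket_zero_left[OF g] bracket_zero_right[OF f] by auto
    then show ?thesis by simp
  next
    case False
    then show ?thesis by (auto simp: S_def)
  qed
  finally show "fn_bracket scale \<alpha> \<beta> f g xs = bracket (i * j) f g xs" .
qed

lemma vector_space_pointwise_scale: "vector_space (pointwise_scale scale)"
  by unfold_locales (simp_all add: pointwise_scale_def fun_eq_iff scale_right_distrib scale_left_distrib)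

lemma total_zero: "0 \<in> bihom_cochains_total scale \<alpha> \<beta>"
  by (rule cochain_in_total[OF cochain_zero])

lemma total_add:
  assumes "F \<in> bihom_cochains_total scale \<alpha> \<beta>" "G \<in> bihom_cochains_total scale \<alpha> \<beta>"
  shows "F + G \<in> bihom_cochains_total scale \<alpha> \<beta>"
proof -
  have "{n. arity_part n (F + G) \<noteq> 0} \<subseteq> {n. arity_part n F \<noteq> 0} \<union> {n. arity_part n G \<noteq> 0}"
    by (auto simp: arity_part_add)
  then have "finite {n. arity_part n (F + G) \<noteq> 0}"
    by (rule finite_subset) (use assms in \<open>simp add: bihom_cochains_total_def\<close>)
  then show ?thesis
    using assms by (simp add: bihom_cochains_total_def bihom_cochains_iff arity_part_add cochain_add)
qed

lemma total_scale:
  assumes "F \<in> bihom_cochains_total scale \<alpha> \<beta>"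
  shows "pointwise_scale scale c F \<in> bihom_cochains_total scale \<alpha> \<beta>"
proof -
  have "{n. arity_part n (pointwise_scale scale c F) \<noteq> 0} \<subseteq> {n. arity_part n F \<noteq> 0}"
    by (auto simp: arity_part_scale pointwise_scale_apply fun_eq_iff)
  then have "finite {n. arity_part n (pointwise_scale scale c F) \<noteq> 0}"
    by (rule finite_subset) (use assms in \<open>simp add: bihom_cochains_total_def\<close>)
  then show ?thesis
    using assms by (simp add: bihom_cochains_total_def bihom_cochains_iff arity_part_scale cochain_scale)
qed

lemma sum_apply: "(\<Sum>i\<in>I. f i) xs = (\<Sum>i\<in>I. f i xs)"
  for f :: "'i \<Rightarrow> 'b \<Rightarrow> 'c::ab_group_add"
  by (induction I rule: infinite_finite_induct) simp_all

lemma total_eq_sum_arity_parts: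
  assumes "F \<in> bihom_cochains_total scale \<alpha> \<beta>"
  shows "F = (\<Sum>n | arity_part n F \<noteq> 0. arity_part n F)"
proof
  fix xs
  have "(\<Sum>n | arity_part n F \<noteq> 0. arity_part n F xs) = (\<Sum>n | arity_part n F \<noteq> 0. if n = length xs then F xs else 0)"
    by (intro sum.cong) (auto simp: arity_part_def)
  also have "\<dots> = (if arity_part (length xs) F \<noteq> 0 then F xs else 0)"
    using assms by (subst sum.delta) (auto simp: bihom_cochains_total_def)
  also have "\<dots> = F xs"
    by (auto simp: arity_part_def fun_eq_iff)
  finally show "F xs = (\<Sum>n | arity_part n F \<noteq> 0. arity_part n F) xs"
    by (simp add: sum_apply)
qed

lemma total_eq_span:
  "bihom_cochains_total scale \<alpha> \<beta> =
   module.span (pointwise_scale scale) (\<Union>i. bihom_cochains_of_degree scale \<alpha> \<beta> i)"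
proof -
  interpret P: vector_space "pointwise_scale scale"
    by (rule vector_space_pointwise_scale)
  show ?thesis
  proof
    show "bihom_cochains_total scale \<alpha> \<beta> \<subseteq> P.span (\<Union>i. bihom_cochains_of_degree scale \<alpha> \<beta> i)"
    proof
      fix F assume F: "F \<in> bihom_cochains_total scale \<alpha> \<beta>"
      have "arity_part n F \<in> (\<Union>i. bihom_cochains_of_degree scale \<alpha> \<beta> i)" for n
        using total_arity_part[OF F, of n] by (auto simp: bihom_cochains_of_degree_eq)
      then show "F \<in> P.span (\<Union>i. bihom_cochains_of_degree scale \<alpha> \<beta> i)"
        by (subst total_eq_sum_arity_parts[OF F]) (intro P.span_sum P.span_base)
    qed
    show "P.span (\<Union>i. bihom_cochains_of_degree scale \<alpha> \<beta> i) \<subseteq> bihom_cochains_total scale \<alpha> \<beta>"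
      by (rule P.span_minimal)
        (auto simp: bihom_cochains_of_degree_eq cochain_in_total P.subspace_def total_zero total_add total_scale)
  qed
qed

text \<open>
  Cochains of different degrees have disjoint supports.
\<close>

lemma cochains_independent:
  assumes "finite I" "\<And>j. j \<in> I \<Longrightarrow> cochain j (f j)" "(\<Sum>j\<in>I. f j) = 0" "i \<in> I"
  shows "f i = 0"
proof
  fix xs
  show "f i xs = 0 xs"
  proof (cases "int (length xs) = i + 1")
    case True
    have "(\<Sum>j\<in>I. f j xs) = (\<Sum>j\<in>I. if j = i then f i xs else 0)"
      using True by (intro sum.cong refl) (auto intro!: cochain_support[OF assms(2)])
    also have "\<dots> = f i xs"
      using assms(1,4) by (simp add: sum.delta)
    finally show ?thesis
      using assms(3) by (simp flip: sum_apply)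
  next
    case False
    then show ?thesis using cochain_support[OF assms(2)[OF assms(4)]] by simp
  qed
qed

lemma graded_lie_algebra_cochains:
  "graded_lie_algebra (pointwise_scale scale) (bihom_cochains_total scale \<alpha> \<beta>)
     (bihom_cochains_of_degree scale \<alpha> \<beta>) (fn_bracket scale \<alpha> \<beta>)"
proof -
  interpret P: vector_space "pointwise_scale scale"
    by (rule vector_space_pointwise_scale)
  show ?thesis
  proof (unfold_locales, unfold bihom_cochains_of_degree_eq mem_Collect_eq)
    show "P.subspace {f. cochain i f}" for i
      by (simp add: P.subspace_def cochain_zero cochain_add cochain_scale)
    show "bihom_cochains_total scale \<alpha> \<beta> = P.span (\<Union>i. {f. cochain i f})"
      using total_eq_span by (simp add: bihom_cochains_of_degree_eq)
    show "f i = 0" if "finite I" "\<And>j. j \<in> I \<Longrightarrow> cochain j (f j)" "(\<Sum>j\<in>I. f j) = 0" "i \<in> I"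
      for I :: "int set" and f i
      using that by (rule cochains_independent)
    fix F G H
    assume T: "F \<in> bihom_cochains_total scale \<alpha> \<beta>" "G \<in> bihom_cochains_total scale \<alpha> \<beta>"
    {
      assume H: "H \<in> bihom_cochains_total scale \<alpha> \<beta>"
      show "fn_bracket scale \<alpha> \<beta> (F + G) H = fn_bracket scale \<alpha> \<beta> F H + fn_bracket scale \<alpha> \<beta> G H"
        by (simp add: fun_eq_iff fn_bracket_total T H total_add arity_part_add case_prod_unfold
            bracket_add_left[OF total_arity_part[OF H]] sum.distrib)
      show "fn_bracket scale \<alpha> \<beta> F (G + H) = fn_bracket scale \<alpha> \<beta> F G + fn_bracket scale \<alpha> \<beta> F H"
        by (simp add: fun_eq_iff fn_bracket_total T H total_add arity_part_add case_prod_unfold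
            bracket_add_right[OF total_arity_part[OF T(1)]] sum.distrib)
    }
    show "fn_bracket scale \<alpha> \<beta> (pointwise_scale scale c F) G = pointwise_scale scale c (fn_bracket scale \<alpha> \<beta> F G)" for c
      by (simp add: fun_eq_iff fn_bracket_total T total_scale arity_part_scale case_prod_unfold
          bracket_scale_left[OF total_arity_part[OF T(2)]] pointwise_scale_apply scale_sum_right)
    show "fn_bracket scale \<alpha> \<beta> F (pointwise_scale scale c G) = pointwise_scale scale c (fn_bracket scale \<alpha> \<beta> F G)" for c
      by (simp add: fun_eq_iff fn_bracket_total T total_scale arity_part_scale case_prod_unfold
          bracket_scale_right[OF total_arity_part[OF T(1)]] pointwise_scale_apply scale_sum_right)
  next
    fix i j f g
    assume f: "cochain i f" and g: "cochain j g"
    show "cochain (i + j) (fn_bracket scale \<alpha> \<beta> f g)"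
      unfolding fn_bracket_cochains[OF f g] by (rule cochain_bracket[OF f g])
    show "fn_bracket scale \<alpha> \<beta> f g = - pointwise_scale scale ((-1) powi (i * j)) (fn_bracket scale \<alpha> \<beta> g f)"
      unfolding fn_bracket_cochains[OF f g] fn_bracket_cochains[OF g f] pointwise_scale_minus_one_powi mult.commute[of j i]
      by (rule bracket_graded_skew)
    fix k h
    assume h: "cochain k h"
    show "fn_bracket scale \<alpha> \<beta> f (fn_bracket scale \<alpha> \<beta> g h) =
        fn_bracket scale \<alpha> \<beta> (fn_bracket scale \<alpha> \<beta> f g) h +
        pointwise_scale scale ((-1) powi (i * j)) (fn_bracket scale \<alpha> \<beta> g (fn_bracket scale \<alpha> \<beta> f h))"
      unfolding pointwise_scale_minus_one_powi fn_bracket_cochains[OF f g] fn_bracket_cochains[OF g h]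
        fn_bracket_cochains[OF f h] fn_bracket_cochains[OF f cochain_bracket[OF g h]]
        fn_bracket_cochains[OF cochain_bracket[OF f g] h] fn_bracket_cochains[OF g cochain_bracket[OF f h]]
      by (rule bracket_graded_Jacobi[OF f g h])
  qed
qed

end

theorem theorem7p2:
  fixes scale :: "complex \<Rightarrow> 'a::ab_group_add \<Rightarrow> 'a"
    and brk :: "'a \<Rightarrow> 'a \<Rightarrow> 'a"
    and \<alpha> \<beta> :: "'a \<Rightarrow> 'a"
  assumes "regular_bihom_lie_algebra scale brk \<alpha> \<beta>"
  shows "graded_lie_algebra (pointwise_scale scale)
           (bihom_cochains_total scale \<alpha> \<beta>)
           (bihom_cochains_of_degree scale \<alpha> \<beta>)
           (fn_bracket scale \<alpha> \<beta>)"
proof -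
  interpret regular_bihom_lie_algebra scale brk \<alpha> \<beta>
    by (rule assms)
  interpret commuting_linear_bijections scale \<alpha> \<beta>
    by (intro commuting_linear_bijections.intro commuting_linear_bijections_axioms.intro
        vector_space_axioms linear_\<alpha> linear_\<beta> commute bij_\<alpha> bij_\<beta>)
  show ?thesis
    by (rule graded_lie_algebra_cochains)
qed

end
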